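(* Let $\phi$ be a gauge and $s\in\mathbb S$. The following are equivalent. (i) $\phi\circ s\in\ell^1$, i.e. $\sum_{n\geq1}\phi(s_n)<\infty$; (ii) for every separable metric space $X$, $\mathcal D_X(\overline s)\subseteq\mathcal N(\mathscr H^\phi_X)$; (iii) for every Cantor cube $X$, $\overline{\mathcal D}_X(\overline s)\subseteq\mathcal N_\sigma(\mathscr H^\phi_X)$; (iv) $\mathcal D_{\ell^2}(\overline s)\subseteq\mathcal N(\mathscr H^\phi_{\ell^2})$.
   Context: $\mathbb S$ is the set of all strictly decreasing sequences $s=(s_n)_{n\geq1}$ of positive reals converging to $0$. For $s\in\mathbb S$ and $k\geq1$ let $s^{\times k}=(s_{kn})_{n\geq1}$, and let $\overline s=\{s^{\times k}:k\geq1\}$. For $S\subseteq\mathbb S$ and a separable metric space $X$, a set $E\subseteq X$ is $S$-dominated if for each $t\in S$ there is a sequence $(E_n)_{n\geq1}$ of subsets of $X$ that covers $E$ and satisfies $\operatorname{diam}E_n<t_n$ for all $n$. $\mathcal D_X(S)$ is the family of all $S$-dominated subsets of $X$, and $\overline{\mathcal D}_X(S)$ is the family of all subsets of $X$ contained in a $\sigma$-compact $S$-dominated subset of $X$. A gauge is a non-decreasing right-continuous function $\phi\colon[0,\infty)\to[0,\infty)$ with $\phi(0)=0$ and $\phi(r)>0$ for $r>0$. The Hausdorff measure is $\mathscr H^\phi_X(E)=\sup_{\delta>0}\inf\{\sum_n\phi(\operatorname{diam}E_n):\{E_n\}\text{ a countable cover of }E\text{ by subsets of }X\text{ with }\operatorname{diam}E_n<\delta\text{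 for all }n\}$. $\mathcal N(\mathscr H^\phi_X)$ is the family of sets $E\subseteq X$ with $\mathscr H^\phi_X(E)=0$, and $\mathcal N_\sigma(\mathscr H^\phi_X)$ is the family of subsets of $X$ of $\sigma$-finite $\mathscr H^\phi_X$ measure. A Cantor cube is a space $\mathbb C(A,r)=(A^\omega,d)$, where $\omega=\{0,1,2,\dots\}$, $A$ is a finite or countable set, $r=(r_n)_{n\geq0}$ is a strictly decreasing sequence of positive reals converging to $0$, and $d(x,y)=r_n$ for $x\neq y$, where $n$ is the first index with $x(n)\neq y(n)$ (and $d(x,x)=0$). $\ell^2$ is the Hilbert space of square-summable real sequences with its norm metric. *)

theory Defs
  imports "HOL-Analysis.Analysis"
begin

text \<open>Quantification over all separable metric spaces is quantification over \<open>X :: 'a metric\<close>, whose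
  carrier may be any subset of \<open>'a\<close>, for an arbitrary type \<open>'a\<close> with an injection from the reals.
  A separable metric space has at most continuum many points, so it is isometric to such an \<open>X\<close>.
  Likewise the alphabets of Cantor cubes are the countable subsets of an arbitrary infinite type.\<close>

section \<open>Null sequences\<close>

text \<open>Sequences indexed by \<open>n \<ge> 1\<close> are functions on \<^typ>\<open>nat\<close> whose value at \<open>0\<close> is
  ignored everywhere below; this keeps \<open>dilate k s n = s (k * n)\<close> literal.\<close>

definition null_seqs :: "(nat \<Rightarrow> real) set" where
  "null_seqs = {s. (\<forall>n\<ge>1. 0 < s n) \<and> (\<forall>n\<ge>1. s (Suc n) < s n) \<and> s \<longlonglongrightarrow> 0}"

definition dilate :: "nat \<Rightarrow> (nat \<Rightarrow> real) \<Rightarrow> nat \<Rightarrow> real" where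
  "dilate k s = (\<lambda>n. s (k * n))"

definition dilates :: "(nat \<Rightarrow> real) \<Rightarrow> (nat \<Rightarrow> real) set" where
  "dilates s = {dilate k s | k. k \<ge> 1}"


section \<open>Dominated sets\<close>

text \<open>The library's \<^const>\<open>diameter\<close> is real-valued, hence unspecified on unbounded sets, and is
  tied to a type class.  Here the diameter may be infinite, and \<open>ediam X {} = 0\<close>.\<close>

definition ediam :: "'a metric \<Rightarrow> 'a set \<Rightarrow> ennreal" where
  "ediam X E = (SUP x\<in>E. SUP y\<in>E. ennreal (mdist X x y))"

definition dominated :: "'a metric \<Rightarrow> (nat \<Rightarrow> real) set \<Rightarrow> 'a set \<Rightarrow> bool" where
  "dominated X S E \<longleftrightarrow> E \<subseteq> mspace X \<and>
     (\<forall>t\<in>S. \<exists>C :: nat \<Rightarrow> 'a set.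
        (\<forall>n\<ge>1. C n \<subseteq> mspace X) \<and> E \<subseteq> (\<Union>n\<in>{1..}. C n) \<and> (\<forall>n\<ge>1. ediam X (C n) < ennreal (t n)))"

definition sigma_compact_in :: "'a topology \<Rightarrow> 'a set \<Rightarrow> bool" where
  "sigma_compact_in T K \<longleftrightarrow> (\<exists>F :: nat \<Rightarrow> 'a set. (\<forall>n. compactin T (F n)) \<and> K = (\<Union>n. F n))"

definition dominated_sets :: "'a metric \<Rightarrow> (nat \<Rightarrow> real) set \<Rightarrow> 'a set set" where
  "dominated_sets X S = {E. dominated X S E}"

definition sc_dominated_sets :: "'a metric \<Rightarrow> (nat \<Rightarrow> real) set \<Rightarrow> 'a set set" where
  "sc_dominated_sets X S =
     {E. \<exists>K. E \<subseteq> K \<and> sigma_compact_in (mtopology_of X) K \<and> dominated X S K}"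


section \<open>Gauges and Hausdorff measures\<close>

text \<open>Only the restriction of \<open>\<phi>\<close> to \<open>[0, \<infinity>)\<close> matters.  Nonnegativity there is
  contained in the last two conditions.\<close>

definition gauge_function :: "(real \<Rightarrow> real) \<Rightarrow> bool" where
  "gauge_function \<phi> \<longleftrightarrow> mono_on {0..} \<phi> \<and> (\<forall>r\<ge>0. continuous (at_right r) \<phi>) \<and>
     \<phi> 0 = 0 \<and> (\<forall>r>0. 0 < \<phi> r)"

text \<open>Countable covers are indexed by all of \<^typ>\<open>nat\<close>; a finite cover is padded by empty sets,
  which contribute \<open>\<phi> 0 = 0\<close>.  As \<open>\<delta>\<close> is real, all diameters that occur are finite.  The infimum
  over no covers is \<open>\<infinity>\<close>.\<close>

definition hausdorff_measure :: "(real \<Rightarrow> real) \<Rightarrow> 'a metric \<Rightarrow> 'a set \<Rightarrow> ennreal" where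
  "hausdorff_measure \<phi> X E =
     (SUP \<delta>\<in>{0::real<..}.
        INF C \<in> {C :: nat \<Rightarrow> 'a set.
                  (\<forall>n. C n \<subseteq> mspace X \<and> ediam X (C n) < ennreal \<delta>) \<and> E \<subseteq> (\<Union>n. C n)}.
          (\<Sum>n. ennreal (\<phi> (enn2real (ediam X (C n))))))"

definition hausdorff_null_sets :: "(real \<Rightarrow> real) \<Rightarrow> 'a metric \<Rightarrow> 'a set set" where
  "hausdorff_null_sets \<phi> X = {E. E \<subseteq> mspace X \<and> hausdorff_measure \<phi> X E = 0}"

definition hausdorff_sigma_finite_sets :: "(real \<Rightarrow> real) \<Rightarrow> 'a metric \<Rightarrow> 'a set set" where
  "hausdorff_sigma_finite_sets \<phi> X =
     {E. \<exists>F :: nat \<Rightarrow> 'a set.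
        (\<forall>n. F n \<subseteq> mspace X \<and> hausdorff_measure \<phi> X (F n) < \<infinity>) \<and> E = (\<Union>n. F n)}"


section \<open>Cantor cubes\<close>

definition cantor_dist :: "(nat \<Rightarrow> real) \<Rightarrow> (nat \<Rightarrow> 'b) \<Rightarrow> (nat \<Rightarrow> 'b) \<Rightarrow> real" where
  "cantor_dist r x y = (if x = y then 0 else r (LEAST n. x n \<noteq> y n))"

definition cantor_space :: "'b set \<Rightarrow> (nat \<Rightarrow> real) \<Rightarrow> (nat \<Rightarrow> 'b) metric" where
  "cantor_space A r = metric ({x. \<forall>n. x n \<in> A}, cantor_dist r)"

definition cantor_scale :: "(nat \<Rightarrow> real) \<Rightarrow> bool" where
  "cantor_scale r \<longleftrightarrow> (\<forall>n. 0 < r n) \<and> (\<forall>n. r (Suc n) < r n) \<and> r \<longlonglongrightarrow> 0"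

definition cantor_cube :: "(nat \<Rightarrow> 'b) metric \<Rightarrow> bool" where
  "cantor_cube X \<longleftrightarrow> (\<exists>A r. countable A \<and> cantor_scale r \<and> X = cantor_space A r)"

lemma Metric_space_cantor:
  assumes "cantor_scale r"
  shows "Metric_space {x. \<forall>n. x n \<in> A} (cantor_dist r)"
proof
  have pos: "0 < r n" for n
    using assms by (simp add: cantor_scale_def)
  have dec: "decseq r"
    using assms by (auto simp: cantor_scale_def decseq_Suc_iff intro: less_imp_le)
  fix x y z :: "nat \<Rightarrow> 'b"
  have nonneg: "0 \<le> cantor_dist r u v" for u v :: "nat \<Rightarrow> 'b"
    using less_imp_le[OF pos] by (simp add: cantor_dist_def)
  show "0 \<le> cantor_dist r x y"
    by (rule nonneg)
  show "cantor_dist r x y = cantor_dist r y x"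
  proof -
    have "(\<lambda>n. x n \<noteq> y n) = (\<lambda>n. y n \<noteq> x n)"
      by auto
    then show ?thesis
      by (auto simp: cantor_dist_def)
  qed
  show "cantor_dist r x y = 0 \<longleftrightarrow> x = y"
    using pos[of "LEAST n. x n \<noteq> y n"] by (cases "x = y") (simp_all add: cantor_dist_def)
  show "cantor_dist r x z \<le> cantor_dist r x y + cantor_dist r y z"
  proof (cases "x = y \<or> y = z \<or> x = z")
    case True
    moreover have "cantor_dist r u u = 0" for u :: "nat \<Rightarrow> 'b"
      by (simp add: cantor_dist_def)
    ultimately show ?thesis
      using nonneg[of x y] nonneg[of y z] by auto
  next
    case False
    define i where "i = (LEAST n. x n \<noteq> z n)"
    have "\<exists>n. x n \<noteq> z n"
      using False by auto
    then have "x i \<noteq> z i"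
      unfolding i_def by (rule LeastI_ex)
    then have "x i \<noteq> y i \<or> y i \<noteq> z i"
      by auto
    then have "(LEAST n. x n \<noteq> y n) \<le> i \<or> (LEAST n. y n \<noteq> z n) \<le> i"
      by (auto intro: Least_le)
    then have "r i \<le> cantor_dist r x y \<or> r i \<le> cantor_dist r y z"
      using False decseqD[OF dec] by (simp add: cantor_dist_def) blast
    moreover have "cantor_dist r x z = r i"
      using False by (simp add: cantor_dist_def i_def)
    ultimately show ?thesis
      using nonneg[of x y] nonneg[of y z] by linarith
  qed
qed

lemma mspace_cantor_space:
  "cantor_scale r \<Longrightarrow> mspace (cantor_space A r) = {x. \<forall>n. x n \<in> A}"
  unfolding cantor_space_def by (rule Metric_space.mspace_metric[OF Metric_space_cantor])

lemma mdist_cantor_space: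
  "cantor_scale r \<Longrightarrow> mdist (cantor_space A r) = cantor_dist r"
  unfolding cantor_space_def by (rule Metric_space.mdist_metric[OF Metric_space_cantor])


section \<open>The space \<open>\<ell>\<^sup>2\<close>\<close>

definition ell2_carrier :: "(nat \<Rightarrow> real) set" where
  "ell2_carrier = {x. (\<lambda>n. (x n)\<^sup>2) summable_on UNIV}"

definition ell2_dist :: "(nat \<Rightarrow> real) \<Rightarrow> (nat \<Rightarrow> real) \<Rightarrow> real" where
  "ell2_dist x y = sqrt (\<Sum>\<^sub>\<infinity>n. (x n - y n)\<^sup>2)"

definition ell2_metric :: "(nat \<Rightarrow> real) metric" where
  "ell2_metric = metric (ell2_carrier, ell2_dist)"

lemma ell2_diff_summable:
  assumes "x \<in> ell2_carrier" "y \<in> ell2_carrier"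
  shows "(\<lambda>n. (x n - y n)\<^sup>2) summable_on UNIV"
proof (rule summable_on_comparison_test)
  show "(\<lambda>n. 2 * (x n)\<^sup>2 + 2 * (y n)\<^sup>2) summable_on UNIV"
    using assms unfolding ell2_carrier_def
    by (intro summable_on_add summable_on_cmult_right) auto
  show "(x n - y n)\<^sup>2 \<le> 2 * (x n)\<^sup>2 + 2 * (y n)\<^sup>2" for n
    using zero_le_power2[of "x n + y n"] by (simp add: power2_eq_square algebra_simps)
qed auto

lemma Metric_space_ell2: "Metric_space ell2_carrier ell2_dist"
proof
  fix x y z :: "nat \<Rightarrow> real"
  show "0 \<le> ell2_dist x y"
    by (simp add: ell2_dist_def infsum_nonneg)
  show "ell2_dist x y = ell2_dist y x"
    by (simp add: ell2_dist_def power2_commute)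
  have L2_le: "L2_set (\<lambda>n. u n - v n) F \<le> ell2_dist u v"
    if "u \<in> ell2_carrier" "v \<in> ell2_carrier" "finite F" for u v F
    unfolding L2_set_def ell2_dist_def real_sqrt_le_iff
    by (rule finite_sum_le_infsum) (use that ell2_diff_summable in auto)
  show "ell2_dist x y = 0 \<longleftrightarrow> x = y" if "x \<in> ell2_carrier" "y \<in> ell2_carrier"
  proof
    assume "ell2_dist x y = 0"
    then have "x n = y n" for n
      using L2_le[OF that, of "{n}"] by (simp add: L2_set_def)
    then show "x = y" by auto
  qed (simp add: ell2_dist_def)
  assume xyz: "x \<in> ell2_carrier" "y \<in> ell2_carrier" "z \<in> ell2_carrier"
  let ?b = "ell2_dist x y + ell2_dist y z"
  have nonneg: "0 \<le> ?b"
    by (simp add: ell2_dist_def infsum_nonneg)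
  have "(\<Sum>\<^sub>\<infinity>n. (x n - z n)\<^sup>2) \<le> ?b\<^sup>2"
  proof (rule infsum_le_finite_sums)
    show "(\<lambda>n. (x n - z n)\<^sup>2) summable_on UNIV"
      using xyz by (intro ell2_diff_summable)
    fix F :: "nat set" assume F: "finite F"
    have "L2_set (\<lambda>n. x n - z n) F \<le> L2_set (\<lambda>n. x n - y n) F + L2_set (\<lambda>n. y n - z n) F"
      using L2_set_triangle_ineq[of "\<lambda>n. x n - y n" "\<lambda>n. y n - z n" F] by simp
    also have "\<dots> \<le> ?b"
      using xyz F by (intro add_mono L2_le)
    finally show "(\<Sum>n\<in>F. (x n - z n)\<^sup>2) \<le> ?b\<^sup>2"
      unfolding L2_set_def by (rule sqrt_le_D)
  qed
  then show "ell2_dist x z \<le> ?b"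
    unfolding ell2_dist_def[of x z] using nonneg by (intro real_le_lsqrt)
qed

lemma mspace_ell2_metric: "mspace ell2_metric = ell2_carrier"
  unfolding ell2_metric_def by (rule Metric_space.mspace_metric[OF Metric_space_ell2])

lemma mdist_ell2_metric: "mdist ell2_metric = ell2_dist"
  unfolding ell2_metric_def by (rule Metric_space.mdist_metric[OF Metric_space_ell2])

end

theory Submission
  imports Defs
begin

text \<open>If \<open>\<Sum>n. \<phi> (s n)\<close> converges to \<open>B\<close>, then \<open>\<Sum>n. \<phi> (s (k * n)) \<le> B / k\<close>, because \<open>\<phi> (s (k * n))\<close>
  is the smallest term of a block of \<open>k\<close> terms of the former series.  A set that is dominated by all
  dilates of \<open>s\<close> therefore has covers with arbitrarily small Hausdorff sums and diameters, in any
  metric space (\<open>dominated_imp_null\<close>).  This gives all three implications from convergence.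

  If the series diverges, then so does \<open>\<Sum>n. \<phi> (s (k * n + 1))\<close> for every \<open>k \<ge> 1\<close>.  This is used to
  build a compact set in a Cantor cube by successive splitting.  The pieces of stage \<open>i\<close> are numbered
  by natural numbers from \<open>0\<close> on, the piece with number \<open>n\<close> has diameter at most \<open>s ((i + 1) * (n + 1) + 1)\<close>,
  and it is split into finitely many pieces of the next stage, with consecutive numbers, until the
  values of \<open>\<phi>\<close> at their prescribed diameters sum to at least twice the value of the piece that is
  split (\<open>divergent_imp_splitting_tree\<close>).  The numbering is the point: one stage is one cover, and its
  \<open>n\<close>-th piece is smaller than the \<open>n\<close>-th entry of a dilate of \<open>s\<close>.  So the limit set is dominated
  by every dilate (\<open>dominated_point_of_paths\<close>).

  On the other hand, the limit set is not of \<open>\<sigma>\<close>-finite measure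
  (\<open>point_of_paths_not_sigma_finite\<close>).  The masses \<open>(1/2) ^ i * \<phi> d\<close> of the pieces, for a piece of
  stage \<open>i\<close> with prescribed diameter \<open>d\<close>, do not decrease in total under splitting.  By a descent along the tree, no
  countable family of pieces covers the whole set unless it has at least the mass of the first piece
  (\<open>path_avoiding_light_nodes\<close>).  In the ultrametric cube every set with more than one point of the
  limit set can be replaced by a piece whose prescribed diameter is not larger, and the pieces of small diameter occur
  only at late stages, where \<open>(1/2) ^ i\<close> is small.  Hence sets of finite Hausdorff measure can be
  covered with arbitrarily little mass (\<open>finite_measure_imp_null_paths\<close>), and so can countable unions
  of them.

  Isometric embeddings carry the set to the other spaces.  A Cantor cube embeds into \<open>\<ell>\<^sup>2\<close> by
  sending a point to a weighted sum of basis vectors that are indexed by its finite prefixes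
  (\<open>isometric_embedding_ell2\<close>).\<close>


section \<open>Diameters, covers and Hausdorff measures\<close>

lemma mdist_le_ediam: "x \<in> C \<Longrightarrow> y \<in> C \<Longrightarrow> ennreal (mdist X x y) \<le> ediam X C"
  unfolding ediam_def by (rule SUP_upper2, assumption, rule SUP_upper)

lemma ediam_leI:
  "(\<And>x y. x \<in> C \<Longrightarrow> y \<in> C \<Longrightarrow> ennreal (mdist X x y) \<le> b) \<Longrightarrow> ediam X C \<le> b"
  unfolding ediam_def by (intro SUP_least)

lemma gauge_mono: "gauge_function \<phi> \<Longrightarrow> 0 \<le> a \<Longrightarrow> a \<le> b \<Longrightarrow> \<phi> a \<le> \<phi> b"
  by (auto simp: gauge_function_def mono_on_def)

lemma gauge_nonneg: "gauge_function \<phi> \<Longrightarrow> 0 \<le> a \<Longrightarrow> 0 \<le> \<phi> a"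
  using gauge_mono[of \<phi> 0 a] by (simp add: gauge_function_def)

lemma gauge_enn2real_mono:
  assumes "gauge_function \<phi>" "a \<le> b" "b < ennreal d"
  shows "ennreal (\<phi> (enn2real a)) \<le> ennreal (\<phi> (enn2real b))"
proof -
  have "b < top"
    using assms(3) by (rule order.strict_trans) (rule ennreal_less_top)
  then show ?thesis
    using assms by (intro ennreal_leI gauge_mono[OF assms(1)] enn2real_mono) auto
qed

text \<open>Replacing the pieces of a cover one by one does not increase its Hausdorff sum if no diameter
  grows.  The old and the new pieces may live in different spaces, so this serves for subsets and for
  isometric embeddings alike.\<close>

lemma hausdorff_measure_le:
  fixes pull :: "'b set \<Rightarrow> 'a set"
  assumes \<phi>: "gauge_function \<phi>"
    and sub: "\<And>C. C \<subseteq> mspace Y \<Longrightarrow> pull C \<subseteq> mspace X"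
    and diam: "\<And>C. C \<subseteq> mspace Y \<Longrightarrow> ediam X (pull C) \<le> ediam Y C"
    and cover: "\<And>C :: nat \<Rightarrow> 'b set. F \<subseteq> (\<Union>n. C n) \<Longrightarrow> E \<subseteq> (\<Union>n. pull (C n))"
  shows "hausdorff_measure \<phi> X E \<le> hausdorff_measure \<phi> Y F"
  unfolding hausdorff_measure_def
proof (rule SUP_mono, rule bexI)
  fix \<delta> :: real assume d: "\<delta> \<in> {0<..}"
  show "\<delta> \<in> {0<..}" by (rule d)
  show "(INF C \<in> {C :: nat \<Rightarrow> 'a set.
          (\<forall>n. C n \<subseteq> mspace X \<and> ediam X (C n) < ennreal \<delta>) \<and> E \<subseteq> (\<Union>n. C n)}.
          (\<Sum>n. ennreal (\<phi> (enn2real (ediam X (C n)))))) \<le>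
       (INF C \<in> {C :: nat \<Rightarrow> 'b set.
          (\<forall>n. C n \<subseteq> mspace Y \<and> ediam Y (C n) < ennreal \<delta>) \<and> F \<subseteq> (\<Union>n. C n)}.
          (\<Sum>n. ennreal (\<phi> (enn2real (ediam Y (C n))))))"
  proof (rule INF_mono)
    fix C :: "nat \<Rightarrow> 'b set"
    assume C: "C \<in> {C. (\<forall>n. C n \<subseteq> mspace Y \<and> ediam Y (C n) < ennreal \<delta>) \<and> F \<subseteq> (\<Union>n. C n)}"
    show "\<exists>C'\<in>{C. (\<forall>n. C n \<subseteq> mspace X \<and> ediam X (C n) < ennreal \<delta>) \<and> E \<subseteq> (\<Union>n. C n)}.
            (\<Sum>n. ennreal (\<phi> (enn2real (ediam X (C' n))))) \<le>
            (\<Sum>n. ennreal (\<phi> (enn2real (ediam Y (C n)))))"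
    proof (rule bexI)
      show "(\<Sum>n. ennreal (\<phi> (enn2real (ediam X (pull (C n)))))) \<le>
            (\<Sum>n. ennreal (\<phi> (enn2real (ediam Y (C n)))))"
        using C by (intro suminf_le summableI gauge_enn2real_mono[OF \<phi>, where d = \<delta>] diam) auto
      have "ediam X (pull (C n)) < ennreal \<delta>" for n
        using C by (intro order.strict_trans1[OF diam]) auto
      moreover have "E \<subseteq> (\<Union>n. pull (C n))"
        using C by (intro cover) auto
      ultimately show "(\<lambda>n. pull (C n)) \<in>
          {C. (\<forall>n. C n \<subseteq> mspace X \<and> ediam X (C n) < ennreal \<delta>) \<and> E \<subseteq> (\<Union>n. C n)}"
        using C sub by auto
    qed
  qed
qed

lemma hausdorff_measure_mono:
  assumes "gauge_function \<phi>" "E \<subseteq> F"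
  shows "hausdorff_measure \<phi> X E \<le> hausdorff_measure \<phi> X F"
  by (rule hausdorff_measure_le[where pull = "\<lambda>C. C"]) (use assms in auto)

lemma hausdorff_cover:
  fixes h \<delta> :: real
  assumes "hausdorff_measure \<phi> X F < ennreal h" "0 < \<delta>"
  obtains C :: "nat \<Rightarrow> 'a set"
  where "\<And>n. C n \<subseteq> mspace X" "\<And>n. ediam X (C n) < ennreal \<delta>" "F \<subseteq> (\<Union>n. C n)"
    "(\<Sum>n. ennreal (\<phi> (enn2real (ediam X (C n))))) < ennreal h"
proof -
  let ?\<C> = "{C :: nat \<Rightarrow> 'a set.
     (\<forall>n. C n \<subseteq> mspace X \<and> ediam X (C n) < ennreal \<delta>) \<and> F \<subseteq> (\<Union>n. C n)}"
  have "(INF C \<in> ?\<C>. (\<Sum>n. ennreal (\<phi> (enn2real (ediam X (C n)))))) \<le> hausdorff_measure \<phi> X F"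
    unfolding hausdorff_measure_def using assms(2) by (intro SUP_upper) auto
  then have "(INF C \<in> ?\<C>. (\<Sum>n. ennreal (\<phi> (enn2real (ediam X (C n)))))) < ennreal h"
    using assms(1) by (rule order.strict_trans1)
  then obtain C where "C \<in> ?\<C>" "(\<Sum>n. ennreal (\<phi> (enn2real (ediam X (C n))))) < ennreal h"
    unfolding INF_less_iff by blast
  then show ?thesis
    using that by blast
qed

lemma hausdorff_null_imp_sigma_finite:
  "hausdorff_null_sets \<phi> X \<subseteq> hausdorff_sigma_finite_sets \<phi> X"
proof
  fix E assume "E \<in> hausdorff_null_sets \<phi> X"
  then show "E \<in> hausdorff_sigma_finite_sets \<phi> X"
    unfolding hausdorff_null_sets_def hausdorff_sigma_finite_sets_def
    by (intro CollectI exI[of _ "\<lambda>_. E"]) simp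
qed


section \<open>Isometric embeddings\<close>

definition isometric_embedding :: "'a metric \<Rightarrow> 'b metric \<Rightarrow> ('a \<Rightarrow> 'b) \<Rightarrow> bool" where
  "isometric_embedding X Y f \<longleftrightarrow> f \<in> mspace X \<rightarrow> mspace Y \<and>
     (\<forall>x\<in>mspace X. \<forall>y\<in>mspace X. mdist Y (f x) (f y) = mdist X x y)"

lemma isometric_embedding_continuous:
  assumes "isometric_embedding X Y f"
  shows "continuous_map (mtopology_of X) (mtopology_of Y) f"
proof (rule Lipschitz_continuous_imp_continuous_map)
  show "Lipschitz_continuous_map X Y f"
    using assms unfolding Lipschitz_continuous_map_def isometric_embedding_def
    by (auto intro!: exI[of _ 1])
qed

lemma dominated_cover:
  assumes "dominated X S E" "t \<in> S"
  obtains C :: "nat \<Rightarrow> 'a set"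
  where "\<And>n. 1 \<le> n \<Longrightarrow> C n \<subseteq> mspace X" "E \<subseteq> (\<Union>n\<in>{1..}. C n)"
    "\<And>n. 1 \<le> n \<Longrightarrow> ediam X (C n) < ennreal (t n)"
proof -
  have "\<exists>C :: nat \<Rightarrow> 'a set. (\<forall>n\<ge>1. C n \<subseteq> mspace X) \<and> E \<subseteq> (\<Union>n\<in>{1..}. C n) \<and>
      (\<forall>n\<ge>1. ediam X (C n) < ennreal (t n))"
    using assms by (simp add: dominated_def)
  then obtain C :: "nat \<Rightarrow> 'a set" where "(\<forall>n\<ge>1. C n \<subseteq> mspace X) \<and>
      E \<subseteq> (\<Union>n\<in>{1..}. C n) \<and> (\<forall>n\<ge>1. ediam X (C n) < ennreal (t n))"
    by (rule exE)
  then show ?thesis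
    by (intro that[of C]) simp_all
qed

lemma dominated_image:
  assumes f: "isometric_embedding X Y f" and E: "dominated X S E"
  shows "dominated Y S (f ` E)"
  unfolding dominated_def
proof (intro conjI ballI)
  show "f ` E \<subseteq> mspace Y"
    using assms by (auto simp: dominated_def isometric_embedding_def)
  fix t assume "t \<in> S"
  with E obtain C where C: "\<And>n. 1 \<le> n \<Longrightarrow> C n \<subseteq> mspace X" "E \<subseteq> (\<Union>n\<in>{1..}. C n)"
      "\<And>n. 1 \<le> n \<Longrightarrow> ediam X (C n) < ennreal (t n)"
    by (rule dominated_cover) blast
  have diam: "ediam Y (f ` C n) \<le> ediam X (C n)" if "n \<ge> 1" for n
  proof (rule ediam_leI)
    fix u v assume "u \<in> f ` C n" "v \<in> f ` C n"
    then obtain x y where xy: "x \<in> C n" "y \<in> C n" "u = f x" "v = f y"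
      by blast
    then have "mdist Y u v = mdist X x y"
      using f C(1)[OF that] unfolding isometric_embedding_def by auto
    then show "ennreal (mdist Y u v) \<le> ediam X (C n)"
      using mdist_le_ediam[OF xy(1,2), of X] by simp
  qed
  have "ediam Y (f ` C n) < ennreal (t n)" if "n \<ge> 1" for n
    using diam[OF that] C(3)[OF that] by (rule order.strict_trans1)
  moreover have "f ` C n \<subseteq> mspace Y" if "n \<ge> 1" for n
    using C(1) f that by (auto simp: isometric_embedding_def Pi_iff)
  moreover have "f ` E \<subseteq> (\<Union>n\<in>{1..}. f ` C n)"
    using image_mono[OF C(2), of f] by (simp add: image_UN)
  ultimately show "\<exists>C. (\<forall>n\<ge>1. C n \<subseteq> mspace Y) \<and> f ` E \<subseteq> (\<Union>n\<in>{1..}. C n) \<and>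
      (\<forall>n\<ge>1. ediam Y (C n) < ennreal (t n))"
    by (intro exI[of _ "\<lambda>n. f ` C n"]) simp
qed

text \<open>Preimages under an isometric embedding keep a cover of the image fine, even if its pieces
  reach outside of the image of the embedding.\<close>

lemma sigma_finite_image_imp_sigma_finite:
  assumes \<phi>: "gauge_function \<phi>" and f: "isometric_embedding X Y f" and E: "E \<subseteq> mspace X"
    and fE: "f ` E \<in> hausdorff_sigma_finite_sets \<phi> Y"
  shows "E \<in> hausdorff_sigma_finite_sets \<phi> X"
proof -
  obtain F :: "nat \<Rightarrow> 'b set" where F: "\<And>n. F n \<subseteq> mspace Y"
      "\<And>n. hausdorff_measure \<phi> Y (F n) < \<infinity>" "f ` E = (\<Union>n. F n)"
    using fE unfolding hausdorff_sigma_finite_sets_def by auto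
  have "hausdorff_measure \<phi> X (E \<inter> f -` F n) \<le> hausdorff_measure \<phi> Y (F n)" for n
  proof (rule hausdorff_measure_le[where pull = "\<lambda>C. mspace X \<inter> f -` C"])
    show "ediam X (mspace X \<inter> f -` C) \<le> ediam Y C" for C
    proof (rule ediam_leI)
      fix x y assume xy: "x \<in> mspace X \<inter> f -` C" "y \<in> mspace X \<inter> f -` C"
      then have "mdist X x y = mdist Y (f x) (f y)"
        using f by (auto simp: isometric_embedding_def)
      then show "ennreal (mdist X x y) \<le> ediam Y C"
        using xy mdist_le_ediam[of "f x" C "f y" Y] by simp
    qed
    show "E \<inter> f -` F n \<subseteq> (\<Union>k. mspace X \<inter> f -` C k)" if "F n \<subseteq> (\<Union>k. C k)" for C :: "nat \<Rightarrow> 'b set"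
    proof
      fix x assume x: "x \<in> E \<inter> f -` F n"
      have "f x \<in> (\<Union>k. C k)"
        by (rule subsetD[OF that]) (use x in simp)
      then obtain k where "f x \<in> C k"
        by auto
      with x E show "x \<in> (\<Union>k. mspace X \<inter> f -` C k)"
        by auto
    qed
  qed (use \<phi> in auto)
  then have "hausdorff_measure \<phi> X (E \<inter> f -` F n) < \<infinity>" for n
    using F(2) by (rule order.strict_trans1)
  moreover have "E \<inter> f -` F n \<subseteq> mspace X" for n
    using E by blast
  moreover have "E = (\<Union>n. E \<inter> f -` F n)"
  proof (intro equalityI subsetI)
    fix x assume x: "x \<in> E"
    then have "f x \<in> (\<Union>n. F n)"
      unfolding F(3)[symmetric] by (rule imageI)
    with x show "x \<in> (\<Union>n. E \<inter> f -` F n)"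
      by simp
  qed simp
  ultimately show ?thesis
    unfolding hausdorff_sigma_finite_sets_def by (intro CollectI exI[of _ "\<lambda>n. E \<inter> f -` F n"] conjI allI)
qed


section \<open>Convergence forces dominated sets to be null\<close>

lemma null_seqs_antimono:
  assumes "s \<in> null_seqs" "1 \<le> m" "m \<le> n"
  shows "s n \<le> s m"
  using assms(3)
proof (induction n rule: dec_induct)
  case (step n)
  have "s (Suc n) < s n"
    using assms(1,2) step by (auto simp: null_seqs_def)
  then show ?case
    using step by simp
qed simp

lemma null_seqs_pos: "s \<in> null_seqs \<Longrightarrow> 1 \<le> n \<Longrightarrow> 0 < s n"
  by (simp add: null_seqs_def)

lemma summable_on_from_1_iff:
  fixes f :: "nat \<Rightarrow> real"
  assumes "\<And>n. 1 \<le> n \<Longrightarrow> 0 \<le> f n"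
  shows "f summable_on {1..} \<longleftrightarrow> summable (\<lambda>n. f (Suc n))"
proof -
  have bij: "bij_betw Suc UNIV {1..}"
    by (auto simp: bij_betw_def image_iff dest: Suc_le_D)
  have "f summable_on {1..} \<longleftrightarrow> (\<lambda>n. f (Suc n)) summable_on UNIV"
    using summable_on_reindex_bij_betw[OF bij, of f] by simp
  also have "\<dots> \<longleftrightarrow> summable (\<lambda>n. f (Suc n))"
    by (rule summable_on_UNIV_nonneg_real_iff) (use assms in auto)
  finally show ?thesis .
qed

text \<open>The sampled term with index \<open>k * Suc n\<close> is the smallest of the block of \<open>k\<close> consecutive
  terms that it ends.\<close>

lemma dilate_partial_sum_le:
  fixes f :: "nat \<Rightarrow> real"
  assumes dec: "\<And>m n. 1 \<le> m \<Longrightarrow> m \<le> n \<Longrightarrow> f n \<le> f m"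
    and nonneg: "\<And>n. 1 \<le> n \<Longrightarrow> 0 \<le> f n" and sm: "summable (\<lambda>n. f (Suc n))"
  shows "real k * (\<Sum>n<N. f (k * Suc n)) \<le> (\<Sum>n. f (Suc n))"
proof -
  have "real k * (\<Sum>n<N. f (k * Suc n)) = (\<Sum>n<N. \<Sum>j\<in>{n * k..<n * k + k}. f (k * Suc n))"
    by (simp add: sum_distrib_left)
  also have "\<dots> \<le> (\<Sum>n<N. \<Sum>j\<in>{n * k..<n * k + k}. f (Suc j))"
    by (intro sum_mono dec) (auto simp: algebra_simps)
  also have "\<dots> = (\<Sum>j<N * k. f (Suc j))"
    by (rule sum.nat_group)
  also have "\<dots> \<le> (\<Sum>n. f (Suc n))"
    using sm nonneg by (intro sum_le_suminf) auto
  finally show ?thesis .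
qed

text \<open>The cover that dominates \<open>E\<close> at \<open>dilate k s\<close> has Hausdorff sum at most
  \<open>(\<Sum>n. \<phi> (s n)) / k\<close>, and its pieces have diameter less than \<open>s k\<close>.  Both bounds tend
  to \<open>0\<close> as \<open>k\<close> grows.\<close>

lemma dominated_imp_null:
  assumes \<phi>: "gauge_function \<phi>" and s: "s \<in> null_seqs" and sm: "(\<lambda>n. \<phi> (s n)) summable_on {1..}"
    and E: "dominated X (dilates s) E"
  shows "E \<in> hausdorff_null_sets \<phi> X"
proof -
  have pos: "0 < s n" if "1 \<le> n" for n
    using null_seqs_pos[OF s that] .
  have dec: "\<phi> (s n) \<le> \<phi> (s m)" if "1 \<le> m" "m \<le> n" for m n
    using that pos[of n] null_seqs_antimono[OF s that] by (intro gauge_mono[OF \<phi>]) auto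
  have nonneg: "0 \<le> \<phi> (s n)" if "1 \<le> n" for n
    using pos[OF that] by (intro gauge_nonneg[OF \<phi>]) auto
  have sm': "summable (\<lambda>n. \<phi> (s (Suc n)))"
    using sm nonneg by (subst (asm) summable_on_from_1_iff)
  define B where "B = (\<Sum>n. \<phi> (s (Suc n)))"
  have "hausdorff_measure \<phi> X E \<le> 0"
    unfolding hausdorff_measure_def
  proof (rule SUP_least)
    fix \<delta> :: real assume "\<delta> \<in> {0<..}"
    then have "0 < \<delta>" by simp
    let ?\<C> = "{C :: nat \<Rightarrow> 'a set.
      (\<forall>n. C n \<subseteq> mspace X \<and> ediam X (C n) < ennreal \<delta>) \<and> E \<subseteq> (\<Union>n. C n)}"
    show "(INF C \<in> ?\<C>. \<Sum>n. ennreal (\<phi> (enn2real (ediam X (C n))))) \<le> 0"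
    proof (rule ennreal_le_epsilon)
      fix e :: real assume "0 < e"
      have "s \<longlonglongrightarrow> 0"
        using s by (simp add: null_seqs_def)
      then have "\<forall>\<^sub>F k in sequentially. s k < \<delta>"
        using \<open>0 < \<delta>\<close> by (rule order_tendstoD)
      moreover have "\<forall>\<^sub>F k in sequentially. B / e < real k"
        using filterlim_real_sequentially by (simp add: filterlim_at_top_dense)
      ultimately have "\<forall>\<^sub>F k in sequentially. s k < \<delta> \<and> B / e < real k \<and> 1 \<le> k"
        using eventually_ge_at_top[of 1] by eventually_elim simp
      then obtain k where k: "s k < \<delta>" "B / e < real k" "1 \<le> k"
        by (auto simp: eventually_sequentially)
      have "dilate k s \<in> dilates s"
        using k(3) by (auto simp: dilates_def)
      with E obtain C where C: "\<And>n. 1 \<le> n \<Longrightarrow> C n \<subseteq> mspace X" "E \<subseteq> (\<Union>n\<in>{1..}. C n)"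
          "\<And>n. 1 \<le> n \<Longrightarrow> ediam X (C n) < ennreal (dilate k s n)"
        by (rule dominated_cover) blast
      have diam: "ediam X (C (Suc n)) < ennreal (s (k * Suc n))" for n
        using C(3)[of "Suc n"] by (simp add: dilate_def)
      have "s (k * Suc n) \<le> \<delta>" for n
        using null_seqs_antimono[OF s k(3), of "k * Suc n"] k(1) by simp
      then have "ediam X (C (Suc n)) < ennreal \<delta>" for n
        using diam by (meson ennreal_leI order.strict_trans2)
      moreover have "E \<subseteq> (\<Union>n. C (Suc n))"
      proof
        fix x assume "x \<in> E"
        then obtain n where "1 \<le> n" "x \<in> C n"
          using C(2) by auto
        then show "x \<in> (\<Union>n. C (Suc n))"
          by (intro UN_I[of "n - 1"]) auto
      qed
      ultimately have "(\<lambda>n. C (Suc n)) \<in> ?\<C>"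
        using C(1) by auto
      then have "(INF C \<in> ?\<C>. \<Sum>n. ennreal (\<phi> (enn2real (ediam X (C n))))) \<le>
          (\<Sum>n. ennreal (\<phi> (enn2real (ediam X (C (Suc n))))))"
        by (rule INF_lower)
      also have "\<dots> \<le> (\<Sum>n. ennreal (\<phi> (s (k * Suc n))))"
      proof (intro suminf_le summableI ennreal_leI gauge_mono[OF \<phi>])
        fix n
        have "0 \<le> s (k * Suc n)"
          using pos[of "k * Suc n"] k(3) by simp
        then show "enn2real (ediam X (C (Suc n))) \<le> s (k * Suc n)"
          using diam[of n] by (intro enn2real_leI) auto
      qed simp
      also have "\<dots> \<le> ennreal e"
      proof (rule suminf_le_const[OF summableI])
        fix N
        have "real k * (\<Sum>n<N. \<phi> (s (k * Suc n))) \<le> B"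
          unfolding B_def by (rule dilate_partial_sum_le) (use dec nonneg sm' in auto)
        also have "B \<le> real k * e"
          using k \<open>0 < e\<close> by (simp add: field_simps)
        finally have "(\<Sum>n<N. \<phi> (s (k * Suc n))) \<le> e"
          using k(3) by (simp add: mult_le_cancel_left)
        moreover have "(\<Sum>n<N. ennreal (\<phi> (s (k * Suc n)))) = ennreal (\<Sum>n<N. \<phi> (s (k * Suc n)))"
          using k(3) by (intro sum_ennreal nonneg) auto
        ultimately show "(\<Sum>n<N. ennreal (\<phi> (s (k * Suc n)))) \<le> ennreal e"
          by (simp add: ennreal_leI)
      qed
      finally show "(INF C \<in> ?\<C>. \<Sum>n. ennreal (\<phi> (enn2real (ediam X (C n))))) \<le> 0 + ennreal e"
        by simp
    qed
  qed
  then show ?thesis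
    using E by (simp add: hausdorff_null_sets_def dominated_def)
qed


section \<open>Trees of natural numbers inside a Cantor cube\<close>

lemma cantor_scale_antimono: "cantor_scale r \<Longrightarrow> m \<le> n \<Longrightarrow> r n \<le> r m"
  by (rule lift_Suc_antimono_le[of r]) (auto simp: cantor_scale_def less_imp_le)

text \<open>The nodes of the tree at each stage are natural numbers, and \<open>ch i n\<close> is the set of children,
  at stage \<open>Suc i\<close>, of the node \<open>n\<close> of stage \<open>i\<close>.  As different nodes of a stage have disjoint
  sets of children, a number together with its stage determines the whole path that leads to it, so
  nodes need not be words.\<close>

locale splitting_tree =
  fixes ch :: "nat \<Rightarrow> nat \<Rightarrow> nat set"
  assumes finite_ch: "finite (ch i n)"
    and ch_nonempty: "ch i n \<noteq> {}"
    and ch_ge: "m \<in> ch i n \<Longrightarrow> n \<le> m"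
    and ch_disjoint: "m \<in> ch i n \<Longrightarrow> m \<in> ch i n' \<Longrightarrow> n = n'"
begin

definition paths :: "(nat \<Rightarrow> nat) set" where
  "paths = {x. x 0 = 0 \<and> (\<forall>i. x (Suc i) \<in> ch i (x i))}"

text \<open>Points of a Cantor cube that belong to different children of the node \<open>n\<close> of stage \<open>i\<close>
  will first differ at this coordinate.  With the scales \<open>r j = s (Suc j)\<close> the set of all points
  of the node then has diameter at most \<open>s (Suc i * Suc n + 1)\<close>, which is less than the entry
  with index \<open>Suc n\<close> of the dilate \<open>s (i * _)\<close>: all nodes of a stage together form a cover as
  the domination by that dilate requires it.\<close>

definition split_level :: "nat \<Rightarrow> nat \<Rightarrow> nat" where
  "split_level i n = Suc i * Suc n"

text \<open>The coordinate \<open>j\<close> of the point that belongs to a path shows the node that the path has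
  reached after the splittings at the levels up to \<open>j\<close>.\<close>

definition point_of :: "(nat \<Rightarrow> nat) \<Rightarrow> nat \<Rightarrow> nat" where
  "point_of x j = x (card {i. split_level i (x i) \<le> j})"

lemma paths_start: "x \<in> paths \<Longrightarrow> x 0 = 0"
  and paths_step: "x \<in> paths \<Longrightarrow> x (Suc i) \<in> ch i (x i)"
  by (simp_all add: paths_def)

lemma paths_mono: "x \<in> paths \<Longrightarrow> i \<le> j \<Longrightarrow> x i \<le> x j"
  by (rule lift_Suc_mono_le[of x]) (auto intro: ch_ge paths_step)

lemma paths_agree_below:
  assumes "x \<in> paths" "y \<in> paths" "x i = y i" "k \<le> i"
  shows "x k = y k"
  using assms(4,3)
proof (induction i rule: dec_induct)
  case (step n)
  then have "x n = y n"
    using ch_disjoint paths_step[OF assms(1), of n] paths_step[OF assms(2), of n] by metis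
  then show ?case
    by (rule step.IH)
qed

lemma paths_first_difference:
  assumes "x \<in> paths" "y \<in> paths" "x \<noteq> y"
  obtains i where "x i = y i" "x (Suc i) \<noteq> y (Suc i)"
proof -
  obtain j where "x j \<noteq> y j"
    using assms(3) by auto
  then have *: "x (LEAST j. x j \<noteq> y j) \<noteq> y (LEAST j. x j \<noteq> y j)"
    by (rule LeastI)
  then obtain i where i: "(LEAST j. x j \<noteq> y j) = Suc i"
    using paths_start[OF assms(1)] paths_start[OF assms(2)] by (cases "LEAST j. x j \<noteq> y j") auto
  then have "x i = y i"
    using not_less_Least[of i "\<lambda>j. x j \<noteq> y j"] by auto
  then show ?thesis
    using that * i by simp
qed

lemma split_level_strict_mono:
  assumes "x \<in> paths"
  shows "strict_mono (\<lambda>i. split_level i (x i))"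
proof (rule strict_monoI_Suc)
  fix i
  have "Suc i * Suc (x i) < Suc (Suc i) * Suc (x i)"
    by simp
  also have "\<dots> \<le> Suc (Suc i) * Suc (x (Suc i))"
    using paths_mono[OF assms, of i "Suc i"] by (intro mult_le_mono2) simp
  finally show "split_level i (x i) < split_level (Suc i) (x (Suc i))"
    unfolding split_level_def .
qed

lemma point_of_at_split_level:
  assumes "x \<in> paths"
  shows "point_of x (split_level i (x i)) = x (Suc i)"
proof -
  have "{k. split_level k (x k) \<le> split_level i (x i)} = {..i}"
    using strict_mono_less_eq[OF split_level_strict_mono[OF assms]] by auto
  then show ?thesis
    by (simp add: point_of_def)
qed

lemma point_of_agree:
  assumes "x \<in> paths" "y \<in> paths" "x i = y i" "j < split_level i (x i)"
  shows "point_of x j = point_of y j"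
proof -
  have agree: "x k = y k" if "k \<le> i" for k
    using paths_agree_below[OF assms(1-3) that] .
  have below: "k < i" if "z \<in> paths" "z i = x i" "split_level k (z k) \<le> j" for z k
  proof -
    have "split_level k (z k) < split_level i (z i)"
      using that assms(4) by simp
    then show "k < i"
      using strict_mono_less[OF split_level_strict_mono[OF that(1)]] by simp
  qed
  have eq: "{k. split_level k (x k) \<le> j} = {k. split_level k (y k) \<le> j}"
  proof (rule Collect_cong)
    fix k
    show "split_level k (x k) \<le> j \<longleftrightarrow> split_level k (y k) \<le> j"
    proof (cases "k < i")
      case True
      then show ?thesis
        using agree[of k] by simp
    next
      case False
      then show ?thesis
        using below[of x k] below[of y k] assms(1-3) by auto
    qed
  qed
  have "{k. split_level k (x k) \<le> j} \<subseteq> {..<i}"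
    using below[of x] assms(1) by auto
  then have "card {k. split_level k (x k) \<le> j} \<le> i"
    using card_mono[of "{..<i}"] by fastforce
  then show ?thesis
    unfolding point_of_def using agree eq by simp
qed

lemma dist_point_of:
  assumes "x \<in> paths" "y \<in> paths" "x i = y i" "x (Suc i) \<noteq> y (Suc i)"
  shows "cantor_dist r (point_of x) (point_of y) = r (split_level i (x i))"
proof -
  let ?l = "split_level i (x i)"
  have diff: "point_of x ?l \<noteq> point_of y ?l"
    using point_of_at_split_level[OF assms(1), of i] point_of_at_split_level[OF assms(2), of i] assms(3,4)
    by simp
  have "(LEAST n. point_of x n \<noteq> point_of y n) = ?l"
  proof (rule Least_equality)
    show "point_of x ?l \<noteq> point_of y ?l"
      by (rule diff)
    show "?l \<le> n" if "point_of x n \<noteq> point_of y n" for n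
      using that point_of_agree[OF assms(1-3), of n] by (meson not_le)
  qed
  then show ?thesis
    using diff by (auto simp: cantor_dist_def)
qed

lemma dist_point_of_le:
  assumes r: "cantor_scale r" and "x \<in> paths" "y \<in> paths" "x i = y i"
  shows "cantor_dist r (point_of x) (point_of y) \<le> r (split_level i (x i))"
proof (cases "x = y")
  case True
  then show ?thesis
    using r by (simp add: cantor_dist_def cantor_scale_def less_imp_le)
next
  case False
  with assms(2,3) obtain k where k: "x k = y k" "x (Suc k) \<noteq> y (Suc k)"
    by (rule paths_first_difference)
  then have "i \<le> k"
    using paths_agree_below[OF assms(2-4), of "Suc k"] by (meson not_less_eq_eq)
  then have "split_level i (x i) \<le> split_level k (x k)"
    using strict_mono_less_eq[OF split_level_strict_mono[OF assms(2)]] by simp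
  then show ?thesis
    unfolding dist_point_of[OF assms(2,3) k] by (rule cantor_scale_antimono[OF r])
qed

text \<open>This form of Koenig's lemma is used twice: with the nodes that have no finite subcover, for the
  compactness of the tree, and with the nodes whose mass exceeds that of a given family of nodes below
  them, for the lower bound of its Hausdorff measure.\<close>

lemma path_along:
  assumes root: "P 0 0" and step: "\<And>i n. P i n \<Longrightarrow> \<exists>m\<in>ch i n. P (Suc i) m"
  obtains x where "x \<in> paths" "\<And>i. P i (x i)"
proof -
  have "\<exists>x. \<forall>i. (P i (x i) \<and> (i = 0 \<longrightarrow> x i = 0)) \<and> x (Suc i) \<in> ch i (x i)"
  proof (rule dependent_nat_choice)
    show "\<exists>n. P 0 n \<and> (0 = (0::nat) \<longrightarrow> n = 0)"
      using root by blast
    show "\<exists>m. (P (Suc i) m \<and> (Suc i = 0 \<longrightarrow> m = 0)) \<and> m \<in> ch i n"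
      if "P i n \<and> (i = 0 \<longrightarrow> n = 0)" for n i
      using step[of i n] that by auto
  qed
  then show ?thesis
    using that by (auto simp: paths_def)
qed

lemma paths_nonempty: "paths \<noteq> {}"
proof -
  obtain x where "x \<in> paths"
    by (rule path_along[of "\<lambda>_ _. True"]) (simp_all add: ex_in_conv ch_nonempty)
  then show ?thesis
    by auto
qed

text \<open>The point of a path without finitely coverable nodes would lie in some member of the open cover,
  and this member alone would cover a whole node of the path, as the diameters of the nodes tend to
  \<open>0\<close>.  Finite coverability passes from the finitely many children to their parent.\<close>

lemma compact_point_of_paths:
  assumes r: "cantor_scale r"
  shows "compactin (mtopology_of (cantor_space UNIV r)) (point_of ` paths)"
  unfolding compactin_def
proof (intro conjI allI impI)
  let ?X = "cantor_space (UNIV :: nat set) r"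
  show "point_of ` paths \<subseteq> topspace (mtopology_of ?X)"
    by (simp add: mspace_cantor_space[OF r])
  fix \<U> assume \<U>: "(\<forall>U\<in>\<U>. openin (mtopology_of ?X) U) \<and> point_of ` paths \<subseteq> \<Union>\<U>"
  define small where
    "small i n \<longleftrightarrow> (\<exists>\<F>. finite \<F> \<and> \<F> \<subseteq> \<U> \<and> point_of ` {y \<in> paths. y i = n} \<subseteq> \<Union>\<F>)" for i n
  have "small 0 0"
  proof (rule ccontr)
    assume "\<not> small 0 0"
    moreover have "\<exists>m\<in>ch i n. \<not> small (Suc i) m" if "\<not> small i n" for i n
    proof (rule ccontr)
      assume "\<not> (\<exists>m\<in>ch i n. \<not> small (Suc i) m)"
      then have "\<forall>m\<in>ch i n. \<exists>\<F>. finite \<F> \<and> \<F> \<subseteq> \<U> \<and> point_of ` {y \<in> paths. y (Suc i) = m} \<subseteq> \<Union>\<F>"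
        by (auto simp: small_def)
      from bchoice[OF this] obtain \<F> where \<F>: "\<forall>m\<in>ch i n. finite (\<F> m) \<and> \<F> m \<subseteq> \<U> \<and>
          point_of ` {y \<in> paths. y (Suc i) = m} \<subseteq> \<Union>(\<F> m)" ..
      have "point_of ` {y \<in> paths. y i = n} \<subseteq> \<Union>(\<Union>m\<in>ch i n. \<F> m)"
      proof
        fix p assume "p \<in> point_of ` {y \<in> paths. y i = n}"
        then obtain y where y: "y \<in> paths" "y i = n" "p = point_of y"
          by auto
        then have "y (Suc i) \<in> ch i n"
          using paths_step[of y i] by simp
        moreover from this have "point_of ` {y' \<in> paths. y' (Suc i) = y (Suc i)} \<subseteq> \<Union>(\<F> (y (Suc i)))"
          using \<F> by blast
        then have "p \<in> \<Union>(\<F> (y (Suc i)))"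
          by (rule subsetD) (use y in auto)
        ultimately show "p \<in> \<Union>(\<Union>m\<in>ch i n. \<F> m)"
          by auto
      qed
      moreover have "finite (\<Union>m\<in>ch i n. \<F> m)" "(\<Union>m\<in>ch i n. \<F> m) \<subseteq> \<U>"
        using \<F> finite_ch by auto
      ultimately have "small i n"
        unfolding small_def by (intro exI[of _ "\<Union>m\<in>ch i n. \<F> m"] conjI)
      with that show False ..
    qed
    ultimately obtain x where x: "x \<in> paths" "\<And>i. \<not> small i (x i)"
      by (rule path_along[of "\<lambda>i n. \<not> small i n"]) auto
    from x(1) \<U> obtain U where U: "U \<in> \<U>" "point_of x \<in> U"
      by auto
    then have "openin (mtopology_of ?X) U"
      using \<U> by simp
    then have "\<exists>e>0. Metric_space.mball (mspace ?X) (mdist ?X) (point_of x) e \<subseteq> U"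
      using U(2) unfolding mtopology_of_def
      by (subst (asm) Metric_space.openin_mtopology[OF Metric_space_mspace_mdist]) simp
    then obtain e where e: "e > 0" "Metric_space.mball (mspace ?X) (mdist ?X) (point_of x) e \<subseteq> U"
      by auto
    have "r \<longlonglongrightarrow> 0"
      using r by (simp add: cantor_scale_def)
    then have "\<forall>\<^sub>F i in sequentially. r i < e"
      using e(1) by (rule order_tendstoD)
    then obtain i where "r i < e"
      by (auto simp: eventually_sequentially)
    moreover have "i \<le> split_level i (x i)"
      by (simp add: split_level_def)
    ultimately have less: "r (split_level i (x i)) < e"
      using cantor_scale_antimono[OF r] by (meson order.strict_trans1)
    have "point_of y \<in> U" if "y \<in> paths" "y i = x i" for y
    proof -
      have "mdist ?X (point_of x) (point_of y) < e"
        using dist_point_of_le[OF r x(1) that(1), of i] that(2) less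
        by (simp add: mdist_cantor_space[OF r])
      then have "point_of y \<in> Metric_space.mball (mspace ?X) (mdist ?X) (point_of x) e"
        by (subst Metric_space.in_mball[OF Metric_space_mspace_mdist]) (simp add: mspace_cantor_space[OF r])
      then show ?thesis
        using e(2) by (rule rev_subsetD)
    qed
    then have "small i (x i)"
      unfolding small_def using U(1) by (intro exI[of _ "{U}"]) auto
    with x(2) show False ..
  qed
  then show "\<exists>\<F>. finite \<F> \<and> \<F> \<subseteq> \<U> \<and> point_of ` paths \<subseteq> \<Union>\<F>"
    unfolding small_def using paths_start by (auto simp: image_subset_iff)
qed

lemma dominated_point_of_paths:
  assumes s: "s \<in> null_seqs" and r: "cantor_scale (\<lambda>n. s (Suc n))"
  shows "dominated (cantor_space UNIV (\<lambda>n. s (Suc n))) (dilates s) (point_of ` paths)"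
  unfolding dominated_def
proof (intro conjI ballI)
  let ?X = "cantor_space (UNIV :: nat set) (\<lambda>n. s (Suc n))"
  show "point_of ` paths \<subseteq> mspace ?X"
    by (simp add: mspace_cantor_space[OF r])
  fix t assume "t \<in> dilates s"
  then obtain k where k: "1 \<le> k" "t = dilate k s"
    by (auto simp: dilates_def)
  \<comment> \<open>The pieces of a cover are counted from \<open>1\<close>, the nodes of a stage from \<open>0\<close>.\<close>
  define C where "C n = point_of ` {y \<in> paths. Suc (y k) = n}" for n
  have "ediam ?X (C n) < ennreal (t n)" if "1 \<le> n" for n
  proof -
    have "ediam ?X (C n) \<le> ennreal (s (Suc (Suc k * n)))"
    proof (rule ediam_leI)
      fix u v assume "u \<in> C n" "v \<in> C n"
      then obtain x y where xy: "x \<in> paths" "y \<in> paths" "Suc (x k) = n" "Suc (y k) = n"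
          "u = point_of x" "v = point_of y"
        unfolding C_def by auto
      have "cantor_dist (\<lambda>n. s (Suc n)) u v \<le> s (Suc (split_level k (x k)))"
        unfolding xy(5,6) by (rule dist_point_of_le[OF r]) (use xy in auto)
      also have "split_level k (x k) = Suc k * n"
        using xy(3) by (simp only: split_level_def)
      finally show "ennreal (mdist ?X u v) \<le> ennreal (s (Suc (Suc k * n)))"
        by (simp add: mdist_cantor_space[OF r] ennreal_leI)
    qed
    also have "\<dots> < ennreal (t n)"
    proof (rule ennreal_lessI)
      have kn: "1 \<le> k * n" "Suc (k * n) \<le> Suc (Suc k * n)"
        using k(1) that by auto
      have "s (Suc (Suc k * n)) \<le> s (Suc (k * n))"
        using null_seqs_antimono[OF s _ kn(2)] by simp
      also have "\<dots> < s (k * n)"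
        using s kn(1) by (simp add: null_seqs_def)
      finally show "s (Suc (Suc k * n)) < t n"
        by (simp add: k(2) dilate_def)
      show "0 < t n"
        using null_seqs_pos[OF s kn(1)] by (simp add: k(2) dilate_def)
    qed
    finally show ?thesis .
  qed
  moreover have "point_of ` paths \<subseteq> (\<Union>n\<in>{1..}. C n)"
    by (auto simp: C_def)
  moreover have "C n \<subseteq> mspace ?X" for n
    by (simp add: mspace_cantor_space[OF r])
  ultimately show "\<exists>C. (\<forall>n\<ge>1. C n \<subseteq> mspace ?X) \<and> point_of ` paths \<subseteq> (\<Union>n\<in>{1..}. C n) \<and>
      (\<forall>n\<ge>1. ediam ?X (C n) < ennreal (t n))"
    by (intro exI[of _ C]) simp
qed


text \<open>If the mass of a node exceeds the total mass of the given nodes at or below it, then the same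
  holds for one of its children, because the children together have at least the mass of their parent
  and every given node lies below at most one of them.  A path of such nodes meets none of the given
  ones.\<close>

lemma path_avoiding_light_nodes:
  fixes v :: "nat \<Rightarrow> nat \<Rightarrow> real"
  assumes nonneg: "\<And>i n. 0 \<le> v i n"
    and mass: "\<And>i n. v i n \<le> (\<Sum>m\<in>ch i n. v (Suc i) m)"
    and z: "\<And>j. z j \<in> paths"
    and light: "(\<Sum>j. ennreal (v (a j) (z j (a j)))) < ennreal (v 0 0)"
  obtains y where "y \<in> paths" "\<And>j. y (a j) \<noteq> z j (a j)"
proof -
  \<comment> \<open>The contribution of the \<open>j\<close>-th given node to the mass at or below the node \<open>n\<close> of
    stage \<open>i\<close>.\<close>
  define V where "V i n j = (if i \<le> a j \<and> z j i = n then ennreal (v (a j) (z j (a j))) else 0)" for i n j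
  have inherit: "(\<Sum>m\<in>ch i n. \<Sum>j. V (Suc i) m j) \<le> (\<Sum>j. V i n j)" for i n
  proof -
    have "(\<Sum>m\<in>ch i n. V (Suc i) m j) \<le> V i n j" for j
    proof (cases "Suc i \<le> a j \<and> z j (Suc i) \<in> ch i n")
      case True
      then have "z j i = n"
        using ch_disjoint paths_step[OF z] by blast
      moreover have "(\<Sum>m\<in>ch i n. V (Suc i) m j) =
          (\<Sum>m\<in>ch i n. if z j (Suc i) = m then ennreal (v (a j) (z j (a j))) else 0)"
        using True by (intro sum.cong) (auto simp: V_def)
      ultimately show ?thesis
        using True by (simp add: sum.delta'[OF finite_ch] V_def)
    next
      case False
      then have "(\<Sum>m\<in>ch i n. V (Suc i) m j) = 0"
        by (intro sum.neutral) (auto simp: V_def)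
      then show ?thesis
        by simp
    qed
    then have "(\<Sum>j. \<Sum>m\<in>ch i n. V (Suc i) m j) \<le> (\<Sum>j. V i n j)"
      by (intro suminf_le summableI)
    then show ?thesis
      by (subst (asm) suminf_sum) (auto intro: summableI)
  qed
  have "(\<Sum>j. V 0 0 j) \<le> (\<Sum>j. ennreal (v (a j) (z j (a j))))"
    by (intro suminf_le summableI) (auto simp: V_def)
  then have root: "(\<Sum>j. V 0 0 j) < ennreal (v 0 0)"
    using light by (rule order.strict_trans1)
  have step: "\<exists>m\<in>ch i n. (\<Sum>j. V (Suc i) m j) < ennreal (v (Suc i) m)"
    if less: "(\<Sum>j. V i n j) < ennreal (v i n)" for i n
  proof (rule ccontr)
    assume "\<not> ?thesis"
    then have ge: "ennreal (v (Suc i) m) \<le> (\<Sum>j. V (Suc i) m j)" if "m \<in> ch i n" for m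
      using that by auto
    have "ennreal (v i n) \<le> ennreal (\<Sum>m\<in>ch i n. v (Suc i) m)"
      using mass by (rule ennreal_leI)
    also have "\<dots> = (\<Sum>m\<in>ch i n. ennreal (v (Suc i) m))"
      using nonneg by (intro sum_ennreal[symmetric])
    also have "\<dots> \<le> (\<Sum>m\<in>ch i n. \<Sum>j. V (Suc i) m j)"
      by (intro sum_mono ge)
    also have "\<dots> \<le> (\<Sum>j. V i n j)"
      by (rule inherit)
    finally show False
      using less by simp
  qed
  obtain y where y: "y \<in> paths" "\<And>i. (\<Sum>j. V i (y i) j) < ennreal (v i (y i))"
    using root step by (rule path_along[of "\<lambda>i n. (\<Sum>j. V i n j) < ennreal (v i n)"]) auto
  have "y (a j) \<noteq> z j (a j)" for j
  proof
    assume eq: "y (a j) = z j (a j)"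
    have "V (a j) (y (a j)) j < ennreal (v (a j) (y (a j)))"
      using y(2) by (rule ennreal_suminf_lessD)
    then show False
      by (simp add: V_def eq)
  qed
  then show ?thesis
    using y(1) that by blast
qed

text \<open>A cover by countably many nodes is given by a sequence \<open>z\<close> of paths and a sequence \<open>a\<close>
  of stages: the \<open>j\<close>-th node is the one that the path \<open>z j\<close> visits at stage \<open>a j\<close>.\<close>

definition light_cover ::
  "(nat \<Rightarrow> nat \<Rightarrow> real) \<Rightarrow> (nat \<Rightarrow> nat) set \<Rightarrow> real \<Rightarrow> (nat \<Rightarrow> nat \<Rightarrow> nat) \<Rightarrow> (nat \<Rightarrow> nat) \<Rightarrow> bool" where
  "light_cover v F \<epsilon> z a \<longleftrightarrow> (\<forall>j. z j \<in> paths) \<and>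
     (\<forall>y\<in>F \<inter> paths. \<exists>j. y (a j) = z j (a j)) \<and>
     (\<Sum>j. ennreal (v (a j) (z j (a j)))) \<le> ennreal \<epsilon>"

definition null_paths :: "(nat \<Rightarrow> nat \<Rightarrow> real) \<Rightarrow> (nat \<Rightarrow> nat) set \<Rightarrow> bool" where
  "null_paths v F \<longleftrightarrow> (\<forall>\<epsilon>>0. \<exists>z a. light_cover v F \<epsilon> z a)"

lemma null_paths_UN:
  fixes F :: "nat \<Rightarrow> (nat \<Rightarrow> nat) set"
  assumes "\<And>p. null_paths v (F p)"
  shows "null_paths v (\<Union>p. F p)"
  unfolding null_paths_def
proof (intro allI impI)
  fix \<epsilon> :: real assume "0 < \<epsilon>"
  then have "0 < \<epsilon> * (1/2) ^ Suc p" for p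
    by simp
  with assms have "\<forall>p. \<exists>z a. light_cover v (F p) (\<epsilon> * (1/2) ^ Suc p) z a"
    unfolding null_paths_def by blast
  then obtain z a where "\<And>p. light_cover v (F p) (\<epsilon> * (1/2) ^ Suc p) (z p) (a p)"
    by metis
  then have za: "\<And>p j. z p j \<in> paths"
      "\<And>p y. y \<in> F p \<Longrightarrow> y \<in> paths \<Longrightarrow> \<exists>j. y (a p j) = z p j (a p j)"
      "\<And>p. (\<Sum>j. ennreal (v (a p j) (z p j (a p j)))) \<le> ennreal (\<epsilon> * (1/2) ^ Suc p)"
    by (simp_all add: light_cover_def)
  define z' where "z' k = (case prod_decode k of (p, j) \<Rightarrow> z p j)" for k
  define a' where "a' k = (case prod_decode k of (p, j) \<Rightarrow> a p j)" for k
  have "(\<Sum>k. ennreal (v (a' k) (z' k (a' k)))) =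
      (\<Sum>k. (\<lambda>(p, j). ennreal (v (a p j) (z p j (a p j)))) (prod_decode k))"
    by (simp add: z'_def a'_def split_beta)
  also have "\<dots> = (\<Sum>p. \<Sum>j. ennreal (v (a p j) (z p j (a p j))))"
    by (rule suminf_ennreal_2dimen) simp
  also have "\<dots> \<le> (\<Sum>p. ennreal (\<epsilon> * (1/2) ^ Suc p))"
    by (intro suminf_le summableI za(3))
  also have "\<dots> = ennreal \<epsilon>"
    using sums_mult[OF power_half_series, of \<epsilon>] \<open>0 < \<epsilon>\<close> by (intro suminf_ennreal_eq) auto
  finally have "(\<Sum>k. ennreal (v (a' k) (z' k (a' k)))) \<le> ennreal \<epsilon>" .
  moreover have "z' k \<in> paths" for k
    using za(1) by (simp add: z'_def split_beta)
  moreover have "\<exists>k. y (a' k) = z' k (a' k)" if y: "y \<in> (\<Union>p. F p) \<inter> paths" for y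
  proof -
    obtain p where "y \<in> F p" "y \<in> paths"
      using y by auto
    then obtain j where "y (a p j) = z p j (a p j)"
      using za(2) by auto
    then show ?thesis
      by (intro exI[of _ "prod_encode (p, j)"]) (simp add: a'_def z'_def)
  qed
  ultimately have "light_cover v (\<Union>p. F p) \<epsilon> z' a'"
    by (simp add: light_cover_def)
  then show "\<exists>z a. light_cover v (\<Union>p. F p) \<epsilon> z a"
    by blast
qed

lemma not_null_paths:
  fixes v :: "nat \<Rightarrow> nat \<Rightarrow> real"
  assumes nonneg: "\<And>i n. 0 \<le> v i n" and root: "0 < v 0 0"
    and mass: "\<And>i n. v i n \<le> (\<Sum>m\<in>ch i n. v (Suc i) m)"
  shows "\<not> null_paths v paths"
proof
  assume "null_paths v paths"
  moreover have "0 < v 0 0 / 2"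
    using root by simp
  ultimately obtain z a where "light_cover v paths (v 0 0 / 2) z a"
    unfolding null_paths_def by blast
  then have za: "\<And>j. z j \<in> paths" "\<And>y. y \<in> paths \<Longrightarrow> \<exists>j. y (a j) = z j (a j)"
      "(\<Sum>j. ennreal (v (a j) (z j (a j)))) \<le> ennreal (v 0 0 / 2)"
    by (simp_all add: light_cover_def)
  have "ennreal (v 0 0 / 2) < ennreal (v 0 0)"
    using root by (intro ennreal_lessI) auto
  with za(3) have "(\<Sum>j. ennreal (v (a j) (z j (a j)))) < ennreal (v 0 0)"
    by (rule order.strict_trans1)
  with nonneg mass za(1) obtain y where "y \<in> paths" "\<And>j. y (a j) \<noteq> z j (a j)"
    by (rule path_avoiding_light_nodes) auto
  with za(2) show False
    by blast
qed

lemma paths_bounded: "\<exists>N. \<forall>x\<in>paths. x i \<le> N"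
proof -
  have "finite ((\<lambda>x. x i) ` paths)"
  proof (induction i)
    case 0
    have "(\<lambda>x. x 0) ` paths \<subseteq> {0}"
      using paths_start by auto
    then show ?case
      by (rule finite_subset) simp
  next
    case (Suc i)
    have "(\<lambda>x. x (Suc i)) ` paths \<subseteq> (\<Union>n\<in>(\<lambda>x. x i) ` paths. ch i n)"
      using paths_step by auto
    then show ?case
      by (rule finite_subset) (rule finite_UN_I[OF Suc finite_ch])
  qed
  then show ?thesis
    by (auto simp: finite_nat_set_iff_bounded_le)
qed

text \<open>A set with at least two points of the tree has a smallest node that contains all of them.  Its
  diameter is at least the distance at which this node splits, because two of its points lie in
  different children.  So a cover by arbitrary sets can be replaced by a cover by nodes that is not
  more expensive, except for an arbitrarily small amount for the sets with at most one point.  The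
  factor \<open>(1/2) ^ i\<close> in the mass makes the new cover cheap when the diameters are small, since small
  nodes belong to late stages.\<close>

lemma finite_measure_imp_null_paths:
  assumes r: "cantor_scale r" and \<phi>: "gauge_function \<phi>"
    and F: "hausdorff_measure \<phi> (cantor_space UNIV r) F < \<infinity>"
  shows "null_paths (\<lambda>i n. (1/2) ^ i * \<phi> (r (split_level i n))) (point_of -` F)"
  unfolding null_paths_def
proof (intro allI impI)
  fix \<epsilon> :: real assume \<epsilon>: "0 < \<epsilon>"
  let ?X = "cantor_space (UNIV :: nat set) r"
  let ?v = "\<lambda>i n. (1/2) ^ i * \<phi> (r (split_level i n))"
  have rpos: "0 < r n" for n
    using r by (simp add: cantor_scale_def)
  obtain h0 where h0: "0 \<le> h0" "hausdorff_measure \<phi> ?X F = ennreal h0"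
    using F by (cases "hausdorff_measure \<phi> ?X F") auto
  define h where "h = h0 + 1"
  have "0 < h" and h: "hausdorff_measure \<phi> ?X F < ennreal h"
    using h0 by (auto simp: h_def intro: ennreal_lessI)
  obtain A where A: "(1/2) ^ A * h < \<epsilon> / 2"
  proof -
    obtain A where "(1/2) ^ A < \<epsilon> / 2 / h"
      using real_arch_pow_inv[of "\<epsilon> / 2 / h" "1/2"] \<epsilon> \<open>0 < h\<close> by auto
    then show ?thesis
      using \<open>0 < h\<close> by (intro that[of A]) (simp add: field_simps)
  qed
  obtain N where N: "\<And>x. x \<in> paths \<Longrightarrow> x A \<le> N"
    using paths_bounded by blast
  define \<delta> where "\<delta> = r (split_level A N)"
  \<comment> \<open>Sets of diameter less than \<open>\<delta>\<close> are too small to contain points from different children of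
    a node of a stage before \<open>A\<close>.\<close>
  have early: "\<delta> \<le> r (split_level i (x i))" if "x \<in> paths" "i < A" for x i
  proof -
    have "x i \<le> N"
      using paths_mono[OF that(1), of i A] N[OF that(1)] that(2) by simp
    then have "split_level i (x i) \<le> split_level A N"
      unfolding split_level_def using that(2) by (intro mult_le_mono) auto
    then show ?thesis
      unfolding \<delta>_def by (rule cantor_scale_antimono[OF r])
  qed
  obtain C where C: "\<And>q. C q \<subseteq> mspace ?X" "\<And>q. ediam ?X (C q) < ennreal \<delta>" "F \<subseteq> (\<Union>q. C q)"
      "(\<Sum>q. ennreal (\<phi> (enn2real (ediam ?X (C q))))) < ennreal h"
    using h rpos[of "split_level A N", folded \<delta>_def] by (rule hausdorff_cover) blast
  have node: "\<exists>z a. z \<in> paths \<and> (\<forall>y\<in>paths. point_of y \<in> D \<longrightarrow> y a = z a) \<and>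
      ennreal (?v a (z a)) \<le> ennreal ((1/2) ^ A) * ennreal (\<phi> (enn2real (ediam ?X D))) + ennreal \<eta>"
    if D: "ediam ?X D < ennreal \<delta>" and "0 < \<eta>" for D \<eta>
  proof (cases "\<exists>x\<in>paths. \<exists>y\<in>paths. point_of x \<in> D \<and> point_of y \<in> D \<and> x \<noteq> y")
    case True
    then obtain x y where xy: "x \<in> paths" "y \<in> paths" "point_of x \<in> D" "point_of y \<in> D" "x \<noteq> y"
      by blast
    \<comment> \<open>The first stage at which a path in \<open>D\<close> leaves \<open>x\<close> gives the smallest node.\<close>
    define splits where "splits a \<longleftrightarrow> (\<exists>y\<in>paths. point_of y \<in> D \<and> y (Suc a) \<noteq> x (Suc a))" for a
    define a where "a = (LEAST a. splits a)"
    obtain b where "x (Suc b) \<noteq> y (Suc b)"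
      using paths_first_difference[OF xy(1,2,5)] by blast
    then have "splits b"
      unfolding splits_def using xy by (intro bexI[of _ y]) auto
    then have "splits a"
      unfolding a_def by (rule LeastI)
    then obtain u where u: "u \<in> paths" "point_of u \<in> D" "u (Suc a) \<noteq> x (Suc a)"
      by (auto simp: splits_def)
    have agree: "u a = x a" if "u \<in> paths" "point_of u \<in> D" for u
    proof (cases a)
      case 0
      then show ?thesis
        using paths_start[OF xy(1)] paths_start[OF that(1)] by simp
    next
      case (Suc c)
      then have "\<not> splits c"
        using not_less_Least[of c splits] by (simp add: a_def)
      then show ?thesis
        using that Suc by (auto simp: splits_def)
    qed
    have "r (split_level a (x a)) = mdist ?X (point_of x) (point_of u)"
      using dist_point_of[OF xy(1) u(1), of a r] agree[OF u(1,2)] u(3)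
      by (simp add: mdist_cantor_space[OF r])
    then have diam: "ennreal (r (split_level a (x a))) \<le> ediam ?X D"
      using mdist_le_ediam[OF xy(3) u(2), of ?X] by simp
    then have "ennreal (r (split_level a (x a))) < ennreal \<delta>"
      using D by (rule order.strict_trans1)
    then have "r (split_level a (x a)) < \<delta>"
      using rpos by (simp add: ennreal_less_iff less_imp_le)
    then have "A \<le> a"
      using early[OF xy(1), of a] by (meson not_le)
    have "r (split_level a (x a)) \<le> enn2real (ediam ?X D)"
    proof -
      have "ediam ?X D < top"
        using D by (rule order.strict_trans) (rule ennreal_less_top)
      then have "enn2real (ennreal (r (split_level a (x a)))) \<le> enn2real (ediam ?X D)"
        using diam by (intro enn2real_mono) auto
      then show ?thesis
        using rpos by (simp add: less_imp_le)
    qed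
    then have "\<phi> (r (split_level a (x a))) \<le> \<phi> (enn2real (ediam ?X D))"
      using rpos by (intro gauge_mono[OF \<phi>]) (auto intro: less_imp_le)
    moreover have "(1/2) ^ a \<le> (1/2 :: real) ^ A"
      using \<open>A \<le> a\<close> by (intro power_decreasing) auto
    moreover have "0 \<le> \<phi> (r (split_level a (x a)))"
      using rpos by (intro gauge_nonneg[OF \<phi>]) (auto intro: less_imp_le)
    ultimately have "?v a (x a) \<le> (1/2) ^ A * \<phi> (enn2real (ediam ?X D))"
      by (intro mult_mono) auto
    then have "ennreal (?v a (x a)) \<le> ennreal ((1/2) ^ A * \<phi> (enn2real (ediam ?X D)))"
      by (rule ennreal_leI)
    also have "\<dots> = ennreal ((1/2) ^ A) * ennreal (\<phi> (enn2real (ediam ?X D)))"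
      by (intro ennreal_mult gauge_nonneg[OF \<phi>]) auto
    also have "\<dots> \<le> \<dots> + ennreal \<eta>"
      by simp
    finally show ?thesis
      using xy(1) agree by (intro exI[of _ x] exI[of _ a]) blast
  next
    case False
    then obtain z where z: "z \<in> paths" "\<And>y. y \<in> paths \<Longrightarrow> point_of y \<in> D \<Longrightarrow> y = z"
      using paths_nonempty by (metis ex_in_conv)
    \<comment> \<open>At most one path runs in \<open>D\<close>, and any late node of it will do.\<close>
    have \<phi>pos: "0 < \<phi> (r 0)"
      using \<phi> rpos[of 0] by (simp add: gauge_function_def)
    obtain a where a: "(1/2) ^ a < \<eta> / \<phi> (r 0)"
      using real_arch_pow_inv[of "\<eta> / \<phi> (r 0)" "1/2"] \<phi>pos \<open>0 < \<eta>\<close> by auto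
    have "\<phi> (r (split_level a (z a))) \<le> \<phi> (r 0)"
      using rpos cantor_scale_antimono[OF r, of 0] by (intro gauge_mono[OF \<phi>]) (auto intro: less_imp_le)
    then have "?v a (z a) \<le> (1/2) ^ a * \<phi> (r 0)"
      by (intro mult_left_mono) auto
    also have "\<dots> \<le> \<eta>"
      using a \<phi>pos by (simp add: field_simps)
    finally have "ennreal (?v a (z a)) \<le> ennreal \<eta>"
      by (rule ennreal_leI)
    also have "\<dots> \<le> ennreal ((1/2) ^ A) * ennreal (\<phi> (enn2real (ediam ?X D))) + ennreal \<eta>"
      by simp
    finally show ?thesis
      using z by (intro exI[of _ z] exI[of _ a]) blast
  qed
  have "\<exists>z a. z \<in> paths \<and> (\<forall>y\<in>paths. point_of y \<in> C q \<longrightarrow> y a = z a) \<and>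
      ennreal (?v a (z a)) \<le> ennreal ((1/2) ^ A) * ennreal (\<phi> (enn2real (ediam ?X (C q)))) +
        ennreal (\<epsilon> / 2 * (1/2) ^ Suc q)" for q
    using C(2) \<epsilon> by (intro node) auto
  then obtain z a where za: "\<And>q. z q \<in> paths \<and> (\<forall>y\<in>paths. point_of y \<in> C q \<longrightarrow> y (a q) = z q (a q)) \<and>
      ennreal (?v (a q) (z q (a q))) \<le>
        ennreal ((1/2) ^ A) * ennreal (\<phi> (enn2real (ediam ?X (C q)))) + ennreal (\<epsilon> / 2 * (1/2) ^ Suc q)"
    by metis
  have "(\<Sum>q. ennreal (?v (a q) (z q (a q)))) \<le>
      (\<Sum>q. ennreal ((1/2) ^ A) * ennreal (\<phi> (enn2real (ediam ?X (C q)))) + ennreal (\<epsilon> / 2 * (1/2) ^ Suc q))"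
    using za by (intro suminf_le summableI) blast
  also have "\<dots> = ennreal ((1/2) ^ A) * (\<Sum>q. ennreal (\<phi> (enn2real (ediam ?X (C q))))) +
      (\<Sum>q. ennreal (\<epsilon> / 2 * (1/2) ^ Suc q))"
    by (simp only: suminf_add[OF summableI summableI, symmetric] ennreal_suminf_cmult)
  also have "(\<Sum>q. ennreal (\<epsilon> / 2 * (1/2) ^ Suc q)) = ennreal (\<epsilon> / 2)"
    using sums_mult[OF power_half_series, of "\<epsilon> / 2"] \<epsilon> by (intro suminf_ennreal_eq) auto
  also have "ennreal ((1/2) ^ A) * (\<Sum>q. ennreal (\<phi> (enn2real (ediam ?X (C q))))) + ennreal (\<epsilon> / 2) \<le>
      ennreal ((1/2) ^ A) * ennreal h + ennreal (\<epsilon> / 2)"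
    using C(4) by (intro add_right_mono mult_left_mono) (auto intro: less_imp_le)
  also have "\<dots> = ennreal ((1/2) ^ A * h + \<epsilon> / 2)"
    using \<open>0 < h\<close> \<epsilon> by (simp add: ennreal_mult ennreal_plus)
  also have "\<dots> \<le> ennreal \<epsilon>"
    using A by (intro ennreal_leI) simp
  finally have "(\<Sum>q. ennreal (?v (a q) (z q (a q)))) \<le> ennreal \<epsilon>" .
  moreover have "\<exists>q. y (a q) = z q (a q)" if y: "y \<in> point_of -` F \<inter> paths" for y
  proof -
    have "point_of y \<in> (\<Union>q. C q)"
      using y C(3) by auto
    then obtain q where "point_of y \<in> C q"
      by auto
    then show ?thesis
      using za y by blast
  qed
  ultimately have "light_cover ?v (point_of -` F) \<epsilon> z a"
    using za by (simp add: light_cover_def)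
  then show "\<exists>z a. light_cover ?v (point_of -` F) \<epsilon> z a"
    by blast
qed

text \<open>Doubling the weights from a node to its children leaves room for the factor \<open>(1/2) ^ i\<close>: the
  masses that carry this factor still do not get lost.  Compared with \<open>\<phi>\<close> of the diameters they
  become negligible, so every set of finite Hausdorff measure is null with respect to them.\<close>

lemma point_of_paths_not_sigma_finite:
  assumes r: "cantor_scale r" and \<phi>: "gauge_function \<phi>"
    and double: "\<And>i n. 2 * \<phi> (r (split_level i n)) \<le> (\<Sum>m\<in>ch i n. \<phi> (r (split_level (Suc i) m)))"
  shows "point_of ` paths \<notin> hausdorff_sigma_finite_sets \<phi> (cantor_space UNIV r)"
proof
  let ?X = "cantor_space (UNIV :: nat set) r"
  let ?v = "\<lambda>i n. (1/2) ^ i * \<phi> (r (split_level i n))"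
  assume "point_of ` paths \<in> hausdorff_sigma_finite_sets \<phi> ?X"
  then obtain F :: "nat \<Rightarrow> (nat \<Rightarrow> nat) set" where F: "\<And>p. hausdorff_measure \<phi> ?X (F p) < \<infinity>"
      "point_of ` paths = (\<Union>p. F p)"
    unfolding hausdorff_sigma_finite_sets_def by auto
  have "null_paths ?v (\<Union>p. point_of -` F p)"
    by (intro null_paths_UN finite_measure_imp_null_paths r \<phi> F(1))
  moreover have "(\<Union>p. point_of -` F p) \<inter> paths = paths \<inter> paths"
    unfolding vimage_UN[symmetric] F(2)[symmetric] by auto
  ultimately have "null_paths ?v paths"
    unfolding null_paths_def light_cover_def by (simp only:)
  moreover have "\<not> null_paths ?v paths"
  proof (rule not_null_paths)
    have pos: "0 < \<phi> (r n)" for n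
      using r \<phi> by (simp add: cantor_scale_def gauge_function_def)
    show "0 \<le> ?v i n" for i n
      using pos[of "split_level i n"] by simp
    show "0 < ?v 0 0"
      using pos by simp
    show "?v i n \<le> (\<Sum>m\<in>ch i n. ?v (Suc i) m)" for i n
    proof -
      have "?v i n = (1/2) ^ Suc i * (2 * \<phi> (r (split_level i n)))"
        by simp
      also have "\<dots> \<le> (1/2) ^ Suc i * (\<Sum>m\<in>ch i n. \<phi> (r (split_level (Suc i) m)))"
        using double by (intro mult_left_mono) auto
      finally show ?thesis
        by (simp only: sum_distrib_left)
    qed
  qed
  ultimately show False
    by contradiction
qed

end


section \<open>Divergence provides a tree\<close>

text \<open>The sampled term with index \<open>k * Suc m + 1\<close> is the largest of the block of \<open>k\<close> terms that it
  starts, so the sampled series dominates \<open>1 / k\<close> of the full one up to finitely many terms.\<close>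

lemma summable_if_dilate_summable:
  fixes f :: "nat \<Rightarrow> real"
  assumes dec: "\<And>m n. 1 \<le> m \<Longrightarrow> m \<le> n \<Longrightarrow> f n \<le> f m"
    and nonneg: "\<And>n. 1 \<le> n \<Longrightarrow> 0 \<le> f n" and k: "1 \<le> k"
    and sm: "summable (\<lambda>n. f (Suc (k * Suc n)))"
  shows "summable (\<lambda>n. f (Suc n))"
proof -
  have "summable (\<lambda>j. f (Suc (j + k)))"
  proof (rule summableI_nonneg_bounded)
    show "0 \<le> f (Suc (j + k))" for j
      by (rule nonneg) simp
    fix n
    have "n \<le> n * k"
      using k by simp
    then have "(\<Sum>j<n. f (Suc (j + k))) \<le> (\<Sum>j<n * k. f (Suc (j + k)))"
      by (intro sum_mono2 nonneg) auto
    also have "\<dots> = (\<Sum>m<n. \<Sum>j\<in>{m * k..<m * k + k}. f (Suc (j + k)))"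
      by (rule sum.nat_group[symmetric])
    also have "\<dots> \<le> (\<Sum>m<n. \<Sum>j\<in>{m * k..<m * k + k}. f (Suc (k * Suc m)))"
      by (intro sum_mono dec) (auto simp: algebra_simps)
    also have "\<dots> = real k * (\<Sum>m<n. f (Suc (k * Suc m)))"
      by (simp add: sum_distrib_left)
    also have "\<dots> \<le> real k * (\<Sum>m. f (Suc (k * Suc m)))"
      by (intro mult_left_mono sum_le_suminf sm nonneg) auto
    finally show "(\<Sum>j<n. f (Suc (j + k))) \<le> real k * (\<Sum>m. f (Suc (k * Suc m)))" .
  qed
  then show ?thesis
    using summable_iff_shift[of "\<lambda>n. f (Suc n)" k] by simp
qed

lemma divergent_blocks:
  fixes b c :: "nat \<Rightarrow> real"
  assumes nonneg: "\<And>n. 0 \<le> b n" and div: "\<not> summable b"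
  obtains e where "strict_mono e" "\<And>n. c n \<le> (\<Sum>m\<in>{e n..<e (Suc n)}. b m)"
proof -
  have block: "\<exists>y. x < y \<and> d \<le> (\<Sum>m\<in>{x..<y}. b m)" for x d
  proof (rule ccontr)
    assume "\<not> (\<exists>y. x < y \<and> d \<le> (\<Sum>m\<in>{x..<y}. b m))"
    then have less: "(\<Sum>m\<in>{x..<y}. b m) < d" if "x < y" for y
      using that by (meson not_le)
    have "summable b"
    proof (rule summableI_nonneg_bounded)
      fix n
      let ?y = "Suc (max n x)"
      have "(\<Sum>m<n. b m) \<le> (\<Sum>m\<in>{0..<?y}. b m)"
        using nonneg by (intro sum_mono2) auto
      also have "\<dots> = (\<Sum>m\<in>{0..<x}. b m) + (\<Sum>m\<in>{x..<?y}. b m)"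
        by (rule sum.atLeastLessThan_concat[symmetric]) auto
      also have "\<dots> \<le> (\<Sum>m\<in>{0..<x}. b m) + d"
        by (intro add_left_mono less_imp_le[OF less]) simp
      finally show "(\<Sum>m<n. b m) \<le> (\<Sum>m\<in>{0..<x}. b m) + d" .
    qed (rule nonneg)
    with div show False ..
  qed
  have "\<exists>e. \<forall>n. True \<and> (e n < e (Suc n) \<and> c n \<le> (\<Sum>m\<in>{e n..<e (Suc n)}. b m))"
    by (rule dependent_nat_choice) (use block in auto)
  then obtain e where e: "\<forall>n. True \<and> (e n < e (Suc n) \<and> c n \<le> (\<Sum>m\<in>{e n..<e (Suc n)}. b m))" ..
  show ?thesis
    by (rule that[of e]) (use e in \<open>simp_all add: strict_mono_Suc_iff\<close>)
qed

text \<open>For every \<open>k \<ge> 1\<close> the values \<open>\<phi> (s (k * n + 1))\<close> have a divergent sum over \<open>n\<close>.  So the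
  natural numbers can be cut into consecutive blocks that have any prescribed sums at least, and the
  \<open>n\<close>-th block can serve as the set of children of the node \<open>n\<close>.\<close>

lemma divergent_imp_splitting_tree:
  assumes \<phi>: "gauge_function \<phi>" and s: "s \<in> null_seqs"
    and div: "\<not> (\<lambda>n. \<phi> (s n)) summable_on {1..}"
  obtains ch where "splitting_tree ch"
    "\<And>i n. 2 * \<phi> (s (Suc (splitting_tree.split_level i n))) \<le>
       (\<Sum>m\<in>ch i n. \<phi> (s (Suc (splitting_tree.split_level (Suc i) m))))"
proof -
  have pos: "0 < \<phi> (s n)" if "1 \<le> n" for n
    using null_seqs_pos[OF s that] \<phi> by (simp add: gauge_function_def)
  have dec: "\<phi> (s n) \<le> \<phi> (s m)" if "1 \<le> m" "m \<le> n" for m n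
    using that null_seqs_pos[OF s, of n] null_seqs_antimono[OF s that] by (intro gauge_mono[OF \<phi>]) auto
  define w where "w i n = \<phi> (s (Suc (Suc i * Suc n)))" for i n
  have wpos: "0 < w i n" for i n
    unfolding w_def by (rule pos) simp
  have "\<not> summable (w i)" for i
  proof
    assume "summable (w i)"
    then have "summable (\<lambda>n. \<phi> (s (Suc n)))"
      unfolding w_def by (intro summable_if_dilate_summable[of "\<lambda>n. \<phi> (s n)" "Suc i"] dec less_imp_le[OF pos]) auto
    with div show False
      using summable_on_from_1_iff[of "\<lambda>n. \<phi> (s n)"] less_imp_le[OF pos] by blast
  qed
  then have "\<exists>e. strict_mono e \<and> (\<forall>n. 2 * w i n \<le> (\<Sum>m\<in>{e n..<e (Suc n)}. w (Suc i) m))" for i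
    using divergent_blocks[of "w (Suc i)" "\<lambda>n. 2 * w i n"] wpos by (metis less_imp_le)
  then obtain e where e: "\<And>i. strict_mono (e i)"
      "\<And>i n. 2 * w i n \<le> (\<Sum>m\<in>{e i n..<e i (Suc n)}. w (Suc i) m)"
    by metis
  define ch where "ch i n = {e i n..<e i (Suc n)}" for i n :: nat
  have tree: "splitting_tree ch"
  proof
    show "finite (ch i n)" for i n
      by (simp add: ch_def)
    show "ch i n \<noteq> {}" for i n
      using e(1)[of i] by (simp add: ch_def strict_mono_Suc_iff)
    show "n \<le> m" if "m \<in> ch i n" for m i n
      using strict_mono_imp_increasing[OF e(1)[of i], of n] that by (simp add: ch_def)
    fix m i n n' assume m: "m \<in> ch i n" "m \<in> ch i n'"
    then have "e i n < e i (Suc n')" "e i n' < e i (Suc n)"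
      by (auto simp: ch_def)
    then show "n = n'"
      using strict_mono_less[OF e(1)[of i]] by auto
  qed
  have "2 * \<phi> (s (Suc (splitting_tree.split_level i n))) \<le>
       (\<Sum>m\<in>ch i n. \<phi> (s (Suc (splitting_tree.split_level (Suc i) m))))" for i n
    using e(2)[of i n] unfolding w_def ch_def splitting_tree.split_level_def[OF tree] .
  with tree show ?thesis
    using that by blast
qed


section \<open>Embeddings of a Cantor cube\<close>

definition prefix_code :: "(nat \<Rightarrow> nat) \<Rightarrow> nat \<Rightarrow> nat" where
  "prefix_code x m = to_nat (map x [0..<Suc m])"

text \<open>For a word of length \<open>m + 1\<close> the square of the weight is
  \<open>((r m)\<^sup>2 - (r (m + 1))\<^sup>2) / 2\<close>.\<close>

definition prefix_weight :: "(nat \<Rightarrow> real) \<Rightarrow> nat \<Rightarrow> real" where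
  "prefix_weight r c = (let n = length (from_nat c :: nat list) in sqrt (((r (n - 1))\<^sup>2 - (r n)\<^sup>2) / 2))"

text \<open>The coordinates of \<open>\<ell>\<^sup>2\<close> are indexed by finite words, and a point is mapped to a
  weighted sum of the basis vectors of its prefixes.  The images of two points that first differ at
  \<open>n\<close> differ in the longer prefixes of both.  The weights are chosen such that the squared weights
  of these prefixes telescope to \<open>(r n)\<^sup>2 / 2\<close> for each of the two points.\<close>

definition ell2_point :: "(nat \<Rightarrow> real) \<Rightarrow> (nat \<Rightarrow> nat) \<Rightarrow> nat \<Rightarrow> real" where
  "ell2_point r x c = (if c \<in> range (prefix_code x) then prefix_weight r c else 0)"

lemma prefix_code_eq_iff: "prefix_code x m = prefix_code y k \<longleftrightarrow> m = k \<and> (\<forall>i\<le>m. x i = y i)"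
proof -
  have "prefix_code x m = prefix_code y k \<longleftrightarrow> map x [0..<Suc m] = map y [0..<Suc k]"
    unfolding prefix_code_def by (rule inj_eq[OF inj_to_nat])
  also have "\<dots> \<longleftrightarrow> m = k \<and> (\<forall>i\<le>m. x i = y i)"
  proof
    assume eq: "map x [0..<Suc m] = map y [0..<Suc k]"
    then have "length (map x [0..<Suc m]) = length (map y [0..<Suc k])"
      by (rule arg_cong)
    then have "m = k"
      by simp
    moreover have "\<forall>i\<in>set [0..<Suc k]. x i = y i"
      using eq \<open>m = k\<close> by (simp only: map_eq_conv)
    ultimately show "m = k \<and> (\<forall>i\<le>m. x i = y i)"
      by auto
  qed (simp add: map_eq_conv del: upt_Suc)
  finally show ?thesis .
qed

lemma has_sum_prefix_weight:
  assumes r: "cantor_scale r"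
  shows "((\<lambda>c. (prefix_weight r c)\<^sup>2) has_sum (r n)\<^sup>2 / 2) (prefix_code x ` {n..})"
proof -
  have weight: "(prefix_weight r (prefix_code x m))\<^sup>2 = (r m)\<^sup>2 / 2 - (r (Suc m))\<^sup>2 / 2" for m
  proof -
    have "0 < r (Suc m)" "r (Suc m) \<le> r m"
      using r by (auto simp: cantor_scale_def less_imp_le)
    then have "(r (Suc m))\<^sup>2 \<le> (r m)\<^sup>2"
      by (intro power_mono) auto
    then show ?thesis
      by (simp add: prefix_weight_def prefix_code_def diff_divide_distrib)
  qed
  have img: "prefix_code x ` {n..} = (\<lambda>m. prefix_code x (m + n)) ` UNIV"
  proof (intro equalityI subsetI)
    fix c assume "c \<in> prefix_code x ` {n..}"
    then obtain m where "n \<le> m" "c = prefix_code x m"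
      by auto
    then show "c \<in> (\<lambda>m. prefix_code x (m + n)) ` UNIV"
      by (intro image_eqI[of _ _ "m - n"]) auto
  qed auto
  have "r \<longlonglongrightarrow> 0"
    using r by (simp add: cantor_scale_def)
  then have "(\<lambda>m. r (m + n)) \<longlonglongrightarrow> 0"
    by (rule LIMSEQ_ignore_initial_segment)
  then have "(\<lambda>m. (r (m + n))\<^sup>2 / 2) \<longlonglongrightarrow> 0\<^sup>2 / 2"
    by (intro tendsto_divide tendsto_power tendsto_const) auto
  then have "(\<lambda>m. (r (m + n))\<^sup>2 / 2 - (r (Suc m + n))\<^sup>2 / 2) sums ((r (0 + n))\<^sup>2 / 2 - 0\<^sup>2 / 2)"
    by (rule telescope_sums')
  then have "(\<lambda>m. (prefix_weight r (prefix_code x (m + n)))\<^sup>2) sums ((r n)\<^sup>2 / 2)"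
    by (simp add: weight)
  then have "((\<lambda>m. (prefix_weight r (prefix_code x (m + n)))\<^sup>2) has_sum (r n)\<^sup>2 / 2) UNIV"
    by (rule sums_nonneg_imp_has_sum) simp
  then show ?thesis
    unfolding img by (subst has_sum_reindex) (auto simp: inj_on_def prefix_code_eq_iff o_def)
qed

lemma ell2_point_in_carrier:
  assumes r: "cantor_scale r"
  shows "ell2_point r x \<in> ell2_carrier"
proof -
  have "((\<lambda>c. (prefix_weight r c)\<^sup>2) has_sum (r 0)\<^sup>2 / 2) (prefix_code x ` {0..})"
    by (rule has_sum_prefix_weight[OF r])
  then have "((\<lambda>c. (ell2_point r x c)\<^sup>2) has_sum (r 0)\<^sup>2 / 2) UNIV"
    by (rule has_sum_cong_neutral[THEN iffD1, rotated -1]) (auto simp: ell2_point_def)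
  then show ?thesis
    by (auto simp: ell2_carrier_def summable_on_def)
qed

lemma ell2_dist_ell2_point:
  assumes r: "cantor_scale r"
  shows "ell2_dist (ell2_point r x) (ell2_point r y) = cantor_dist r x y"
proof (cases "x = y")
  case True
  then show ?thesis
    by (simp add: ell2_dist_def cantor_dist_def)
next
  case False
  define n where "n = (LEAST n. x n \<noteq> y n)"
  have "\<exists>n. x n \<noteq> y n"
    using False by auto
  then have differ: "x n \<noteq> y n"
    unfolding n_def by (rule LeastI_ex)
  have agree: "x i = y i" if "i < n" for i
    using not_less_Least[of i "\<lambda>n. x n \<noteq> y n"] that by (simp add: n_def)
  let ?X = "prefix_code x ` {n..}" and ?Y = "prefix_code y ` {n..}"
  have "?X \<inter> ?Y = {}"
    using differ by (auto simp: prefix_code_eq_iff)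
  then have sum_on: "((\<lambda>c. (prefix_weight r c)\<^sup>2) has_sum ((r n)\<^sup>2 / 2 + (r n)\<^sup>2 / 2)) (?X \<union> ?Y)"
    by (intro has_sum_Un_disjoint has_sum_prefix_weight[OF r])
  have inside: "(ell2_point r x c - ell2_point r y c)\<^sup>2 = (prefix_weight r c)\<^sup>2" if "c \<in> ?X \<union> ?Y" for c
  proof -
    from that consider m where "n \<le> m" "c = prefix_code x m" | m where "n \<le> m" "c = prefix_code y m"
      by auto
    then show ?thesis
    proof cases
      case 1
      then have "c \<in> range (prefix_code x)" "c \<notin> range (prefix_code y)"
        using differ by (auto simp: prefix_code_eq_iff)
      then show ?thesis
        by (simp add: ell2_point_def)
    next
      case 2
      then have "c \<notin> range (prefix_code x)" "c \<in> range (prefix_code y)"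
        using differ by (auto simp: prefix_code_eq_iff)
      then show ?thesis
        by (simp add: ell2_point_def)
    qed
  qed
  have outside: "(ell2_point r x c - ell2_point r y c)\<^sup>2 = 0" if "c \<notin> ?X \<union> ?Y" for c
  proof -
    have short: "prefix_code x m = prefix_code y m" if "m < n" for m
      using that agree by (simp add: prefix_code_eq_iff)
    have "c \<in> range (prefix_code x) \<longleftrightarrow> c \<in> range (prefix_code y)"
    proof
      assume "c \<in> range (prefix_code x)"
      then obtain m where "c = prefix_code x m"
        by auto
      then show "c \<in> range (prefix_code y)"
        using that short[of m] by (cases "m < n") auto
    next
      assume "c \<in> range (prefix_code y)"
      then obtain m where "c = prefix_code y m"
        by auto
      then show "c \<in> range (prefix_code x)"
        using that short[of m, symmetric] by (cases "m < n") auto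
    qed
    then show ?thesis
      by (simp add: ell2_point_def)
  qed
  from sum_on have "((\<lambda>c. (ell2_point r x c - ell2_point r y c)\<^sup>2) has_sum ((r n)\<^sup>2 / 2 + (r n)\<^sup>2 / 2)) UNIV"
    by (rule has_sum_cong_neutral[THEN iffD1, rotated -1]) (use inside outside in auto)
  then have "(\<Sum>\<^sub>\<infinity>c. (ell2_point r x c - ell2_point r y c)\<^sup>2) = (r n)\<^sup>2"
    using infsumI by force
  then have "ell2_dist (ell2_point r x) (ell2_point r y) = r n"
    using r by (simp add: ell2_dist_def cantor_scale_def less_imp_le)
  then show ?thesis
    using False by (simp add: cantor_dist_def n_def)
qed

lemma isometric_embedding_ell2:
  assumes "cantor_scale r"
  shows "isometric_embedding (cantor_space UNIV r) ell2_metric (ell2_point r)"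
  using assms ell2_point_in_carrier ell2_dist_ell2_point
  by (simp add: isometric_embedding_def mspace_ell2_metric mdist_ell2_metric
      mspace_cantor_space mdist_cantor_space)

lemma isometric_embedding_alphabet:
  assumes r: "cantor_scale r" and \<iota>: "inj \<iota>"
  shows "isometric_embedding (cantor_space UNIV r) (cantor_space (range \<iota>) r) (\<lambda>x. \<iota> \<circ> x)"
proof -
  have "cantor_dist r (\<iota> \<circ> x) (\<iota> \<circ> y) = cantor_dist r x y" for x y
    using \<iota> by (auto simp: cantor_dist_def inj_eq fun_eq_iff)
  then show ?thesis
    by (simp add: isometric_embedding_def mspace_cantor_space[OF r] mdist_cantor_space[OF r])
qed

lemma isometric_copy:
  assumes "inj_on h (mspace X)"
  obtains Y where "mspace Y = h ` mspace X" "isometric_embedding X Y h"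
proof -
  let ?g = "the_inv_into (mspace X) h"
  let ?d = "\<lambda>u v. mdist X (?g u) (?g v)"
  have g: "?g (h x) = x" if "x \<in> mspace X" for x
    using assms that by (rule the_inv_into_f_f)
  have Y: "Metric_space (h ` mspace X) ?d"
    by unfold_locales (auto simp: g mdist_commute mdist_triangle)
  show ?thesis
  proof (rule that[of "metric (h ` mspace X, ?d)"])
    show "isometric_embedding X (metric (h ` mspace X, ?d)) h"
      by (simp add: isometric_embedding_def Metric_space.mspace_metric[OF Y]
          Metric_space.mdist_metric[OF Y] g)
  qed (rule Metric_space.mspace_metric[OF Y])
qed

lemma separable_cantor_space:
  assumes r: "cantor_scale r"
  shows "separable_space (mtopology_of (cantor_space (UNIV :: nat set) r))"
proof -
  let ?X = "cantor_space (UNIV :: nat set) r"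
  define pad where "pad l n = (if n < length l then l ! n else 0)" for l :: "nat list" and n
  have "x \<in> mtopology_of ?X closure_of (range pad)" for x
    unfolding mtopology_of_def Metric_space.metric_closure_of[OF Metric_space_mspace_mdist]
  proof (intro CollectI conjI allI impI)
    show "x \<in> mspace ?X"
      by (simp add: mspace_cantor_space[OF r])
    fix e :: real assume "0 < e"
    have "r \<longlonglongrightarrow> 0"
      using r by (simp add: cantor_scale_def)
    then have "\<forall>\<^sub>F n in sequentially. r n < e"
      using \<open>0 < e\<close> by (rule order_tendstoD)
    then obtain N where N: "r N < e"
      by (auto simp: eventually_sequentially)
    let ?y = "pad (map x [0..<N])"
    have "cantor_dist r x ?y < e"
    proof (cases "x = ?y")
      case True
      then show ?thesis
        using \<open>0 < e\<close> unfolding cantor_dist_def by simp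
    next
      case False
      then have "\<exists>n. x n \<noteq> ?y n"
        by auto
      then have "x (LEAST n. x n \<noteq> ?y n) \<noteq> ?y (LEAST n. x n \<noteq> ?y n)"
        by (rule LeastI_ex)
      then have "N \<le> (LEAST n. x n \<noteq> ?y n)"
        by (rule contrapos_np) (simp add: pad_def)
      then have "r (LEAST n. x n \<noteq> ?y n) \<le> r N"
        by (rule cantor_scale_antimono[OF r])
      then show ?thesis
        using False N by (simp add: cantor_dist_def)
    qed
    then have "?y \<in> Metric_space.mball (mspace ?X) (mdist ?X) x e"
      by (subst Metric_space.in_mball[OF Metric_space_mspace_mdist])
        (simp add: mspace_cantor_space[OF r] mdist_cantor_space[OF r])
    then show "\<exists>y\<in>range pad. y \<in> Metric_space.mball (mspace ?X) (mdist ?X) x e"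
      by blast
  qed
  then have "mtopology_of ?X closure_of (range pad) = topspace (mtopology_of ?X)"
    by (simp add: set_eq_iff mspace_cantor_space[OF r])
  then show ?thesis
    unfolding separable_space_def
    by (intro exI[of _ "range pad"]) (simp add: mspace_cantor_space[OF r])
qed

lemma inj_sequences_into_continuum:
  assumes "\<exists>f :: real \<Rightarrow> 'a. inj f"
  obtains h :: "(nat \<Rightarrow> nat) \<Rightarrow> 'a" where "inj h"
proof -
  obtain f :: "real \<Rightarrow> 'a" where "inj f"
    using assms ..
  obtain g :: "nat set \<Rightarrow> real" where "bij g"
    using nat_sets_eqpoll_reals unfolding eqpoll_def by auto
  have "inj (\<lambda>x :: nat \<Rightarrow> nat. range (\<lambda>n. prod_encode (n, x n)))"
  proof
    fix x y :: "nat \<Rightarrow> nat"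
    assume eq: "range (\<lambda>n. prod_encode (n, x n)) = range (\<lambda>n. prod_encode (n, y n))"
    show "x = y"
    proof
      fix n
      have "prod_encode (n, x n) \<in> range (\<lambda>n. prod_encode (n, y n))"
        unfolding eq[symmetric] by (rule rangeI)
      then show "x n = y n"
        by auto
    qed
  qed
  then have "inj (\<lambda>x :: nat \<Rightarrow> nat. f (g (range (\<lambda>n. prod_encode (n, x n)))))"
    using \<open>inj f\<close> bij_is_inj[OF \<open>bij g\<close>] by (auto simp: inj_def)
  then show ?thesis
    by (rule that)
qed


section \<open>Characterizations of convergence\<close>

text \<open>One set refutes all three inclusions, after it has been moved by isometric embeddings: it is
  compact, as the statement about Cantor cubes needs it, and sets that are not
  \<open>\<sigma>\<close>-finite are in particular not null.  The scales of its cube are the entries of \<open>s\<close>.\<close>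

lemma divergent_imp_compact_counterexample:
  assumes \<phi>: "gauge_function \<phi>" and s: "s \<in> null_seqs"
    and div: "\<not> (\<lambda>n. \<phi> (s n)) summable_on {1..}"
  obtains r E where "cantor_scale r" "compactin (mtopology_of (cantor_space UNIV r)) E"
    "dominated (cantor_space (UNIV :: nat set) r) (dilates s) E"
    "E \<notin> hausdorff_sigma_finite_sets \<phi> (cantor_space UNIV r)"
proof -
  let ?r = "\<lambda>n. s (Suc n)"
  have r: "cantor_scale ?r"
    using s LIMSEQ_Suc[of s 0] by (auto simp: cantor_scale_def null_seqs_def)
  obtain ch where tree: "splitting_tree ch"
    and double: "\<And>i n. 2 * \<phi> (s (Suc (splitting_tree.split_level i n))) \<le>
       (\<Sum>m\<in>ch i n. \<phi> (s (Suc (splitting_tree.split_level (Suc i) m))))"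
    using \<phi> s div by (rule divergent_imp_splitting_tree) blast
  interpret splitting_tree ch
    by (rule tree)
  show ?thesis
  proof (rule that[OF r])
    show "compactin (mtopology_of (cantor_space UNIV ?r)) (point_of ` paths)"
      by (rule compact_point_of_paths[OF r])
    show "dominated (cantor_space UNIV ?r) (dilates s) (point_of ` paths)"
      by (rule dominated_point_of_paths[OF s r])
    show "point_of ` paths \<notin> hausdorff_sigma_finite_sets \<phi> (cantor_space UNIV ?r)"
      by (rule point_of_paths_not_sigma_finite[OF r \<phi> double])
  qed
qed

theorem theorem4p1:
  fixes \<phi> :: "real \<Rightarrow> real" and s :: "nat \<Rightarrow> real"
  assumes "gauge_function \<phi>" and "s \<in> null_seqs"
    and "\<exists>f :: real \<Rightarrow> 'a. inj f" and "infinite (UNIV :: 'b set)"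
  shows "((\<lambda>n. \<phi> (s n)) summable_on {1..} \<longleftrightarrow>
            (\<forall>X :: 'a metric. separable_space (mtopology_of X) \<longrightarrow>
               dominated_sets X (dilates s) \<subseteq> hausdorff_null_sets \<phi> X)) \<and>
         ((\<lambda>n. \<phi> (s n)) summable_on {1..} \<longleftrightarrow>
            (\<forall>X :: (nat \<Rightarrow> 'b) metric. cantor_cube X \<longrightarrow>
               sc_dominated_sets X (dilates s) \<subseteq> hausdorff_sigma_finite_sets \<phi> X)) \<and>
         ((\<lambda>n. \<phi> (s n)) summable_on {1..} \<longleftrightarrow>
            dominated_sets ell2_metric (dilates s) \<subseteq> hausdorff_null_sets \<phi> ell2_metric)"
proof (cases "(\<lambda>n. \<phi> (s n)) summable_on {1..}")
  case True
  note null = dominated_imp_null[OF assms(1,2) True]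
  have dominated_null: "dominated_sets X (dilates s) \<subseteq> hausdorff_null_sets \<phi> X" for X :: "'x metric"
    using null by (auto simp: dominated_sets_def)
  have sc_sigma_finite: "sc_dominated_sets X (dilates s) \<subseteq> hausdorff_sigma_finite_sets \<phi> X" for X :: "(nat \<Rightarrow> 'b) metric"
  proof
    fix E assume "E \<in> sc_dominated_sets X (dilates s)"
    then obtain K where "E \<subseteq> K" "dominated X (dilates s) K"
      by (auto simp: sc_dominated_sets_def)
    then have "K \<in> hausdorff_null_sets \<phi> X"
      using null by blast
    then have "E \<in> hausdorff_null_sets \<phi> X"
      using hausdorff_measure_mono[OF assms(1) \<open>E \<subseteq> K\<close>, of X] \<open>E \<subseteq> K\<close>
      by (auto simp: hausdorff_null_sets_def)
    then show "E \<in> hausdorff_sigma_finite_sets \<phi> X"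
      using hausdorff_null_imp_sigma_finite by blast
  qed
  show ?thesis
    using True by (simp add: dominated_null sc_sigma_finite)
next
  case False
  with assms(1,2) obtain r E where r: "cantor_scale r"
    and compact: "compactin (mtopology_of (cantor_space UNIV r)) E"
    and dominated: "dominated (cantor_space (UNIV :: nat set) r) (dilates s) E"
    and not_finite: "E \<notin> hausdorff_sigma_finite_sets \<phi> (cantor_space UNIV r)"
    by (rule divergent_imp_compact_counterexample) blast
  let ?C = "cantor_space (UNIV :: nat set) r"
  have E: "E \<subseteq> mspace ?C"
    using dominated by (simp add: dominated_def)
  have image_not_finite: "f ` E \<notin> hausdorff_sigma_finite_sets \<phi> Y"
    if "isometric_embedding ?C Y f" for Y :: "'x metric" and f
    using sigma_finite_image_imp_sigma_finite[OF assms(1) that E] not_finite by blast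
  have "\<exists>X :: 'a metric. separable_space (mtopology_of X) \<and>
      \<not> dominated_sets X (dilates s) \<subseteq> hausdorff_null_sets \<phi> X"
  proof -
    obtain h :: "(nat \<Rightarrow> nat) \<Rightarrow> 'a" where "inj h"
      using assms(3) by (rule inj_sequences_into_continuum)
    then have "inj_on h (mspace ?C)"
      by (rule inj_on_subset) simp
    then obtain X where X: "mspace X = h ` mspace ?C" "isometric_embedding ?C X h"
      by (rule isometric_copy)
    have "separable_space (mtopology_of X)"
      by (rule separable_space_continuous_map_image[OF separable_cantor_space[OF r]
            isometric_embedding_continuous[OF X(2)]]) (simp add: X(1))
    moreover have "h ` E \<in> dominated_sets X (dilates s)"
      using dominated_image[OF X(2) dominated] by (simp add: dominated_sets_def)
    moreover have "h ` E \<notin> hausdorff_null_sets \<phi> X"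
      using image_not_finite[OF X(2)] hausdorff_null_imp_sigma_finite by blast
    ultimately show ?thesis
      by blast
  qed
  moreover have "\<exists>X :: (nat \<Rightarrow> 'b) metric. cantor_cube X \<and>
      \<not> sc_dominated_sets X (dilates s) \<subseteq> hausdorff_sigma_finite_sets \<phi> X"
  proof -
    obtain \<iota> :: "nat \<Rightarrow> 'b" where "inj \<iota>"
      using infinite_countable_subset[OF assms(4)] by blast
    let ?X = "cantor_space (range \<iota>) r" and ?f = "\<lambda>x. \<iota> \<circ> x"
    have f: "isometric_embedding ?C ?X ?f"
      by (rule isometric_embedding_alphabet[OF r \<open>inj \<iota>\<close>])
    have "cantor_cube ?X"
      unfolding cantor_cube_def using r by (intro exI[of _ "range \<iota>"] exI[of _ r]) simp
    moreover have "?f ` E \<in> sc_dominated_sets ?X (dilates s)"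
    proof -
      have "compactin (mtopology_of ?X) (?f ` E)"
        by (rule image_compactin[OF compact isometric_embedding_continuous[OF f]])
      then have "sigma_compact_in (mtopology_of ?X) (?f ` E)"
        unfolding sigma_compact_in_def by (intro exI[of _ "\<lambda>_. ?f ` E"]) simp
      then show ?thesis
        unfolding sc_dominated_sets_def using dominated_image[OF f dominated] by blast
    qed
    ultimately show ?thesis
      using image_not_finite[OF f] by blast
  qed
  moreover have "\<not> dominated_sets ell2_metric (dilates s) \<subseteq> hausdorff_null_sets \<phi> ell2_metric"
  proof -
    note f = isometric_embedding_ell2[OF r]
    have "ell2_point r ` E \<in> dominated_sets ell2_metric (dilates s)"
      using dominated_image[OF f dominated] by (simp add: dominated_sets_def)
    moreover have "ell2_point r ` E \<notin> hausdorff_null_sets \<phi> ell2_metric"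
      using image_not_finite[OF f] hausdorff_null_imp_sigma_finite by blast
    ultimately show ?thesis
      by blast
  qed
  ultimately show ?thesis
    using False by blast
qed

end
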